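(* Let $Z$ be a real neutral strongly facially symmetric space that possesses a unitary geometric tripotent. Then there exists a measure space $(\Omega,\Sigma,\mu)$, with measure $\mu$ having the direct sum property, such that $Z$ is isometrically isomorphic to the space $L_1(\Omega,\Sigma,\mu)$.
   Context: Let $Z$ be a real or complex normed space with unit ball $Z_1=\{f\in Z:\|f\|\le 1\}$ and dual $U=Z^*$. Elements $f,g\in Z$ are orthogonal, written $f\diamond g$, if $\|f+g\|=\|f-g\|=\|f\|+\|g\|$. For a subset $S$, $S^\diamond$ is the set of all elements of $Z$ orthogonal to every element of $S$. A norm exposed face of $Z_1$ is a non-empty set of the form $F_u=\{f\in Z_1:u(f)=1\}$ with $u\in Z^*$, $\|u\|=1$. An element $u\in Z^*$ is a projective unit if $\|u\|=1$ and $\langle u,f\rangle=0$ for all $f\in F_u^\diamond$. A norm exposed face $F_u$ is a symmetric face if there is a linear isometry $S_u$ of $Z$ onto $Z$ with $S_u^2=I$ (a symmetry associated with $F_u$) whose fixed point set is $(\overline{\mathrm{sp}}\,F_u)\oplus F_u^\diamond$. $Z$ is weakly facially symmetric (WFS) if every norm exposed face of $Z_1$ is symmetric. For a symmetric face $F_u$, the geometric Peirce projections are the contractive projections $P_1(F_u)=(I-S_u)/2$ (onto the $-1$ eigenspace of $S_u$), and $P_2(F_u)$, $P_0(F_u)$ the projections of $Z$ onto $\overline{\mathrm{sp}}\,F_u$ and $F_u^\diamond$ respectively (with $P_2(F_u)+P_1(F_u)+P_0(F_u)=I$). A geometric tripotent is a projective unit $u\in Z^*$ such that $F_u$ is a symmetric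 face and $S_u^*u=u$ for a symmetry $S_u$ corresponding to $F_u$. A contractive projection $Q$ on $Z$ is neutral if, for each $f\in Z$, $\|Qf\|=\|f\|$ implies $Qf=f$. $Z$ is neutral if $P_2(F_u)$ is neutral for every symmetric face $F_u$. A WFS space $Z$ is strongly facially symmetric (SFS) if for every norm exposed face $F_u$ of $Z_1$ and every $y\in Z^*$ with $\|y\|=1$ and $F_u\subset F_y$, one has $S_u^*y=y$, where $S_u$ is a symmetry associated with $F_u$. A geometric tripotent $e$ is unitary if $Z_1=\mathrm{co}(F_e\cup F_{-e})$, i.e. the convex hull of $F_e\cup F_{-e}$ is the whole unit ball. A measure space $(\Omega,\Sigma,\mu)$ has the direct sum property if there is a family $\{\Omega_i\}_{i\in J}\subset\Sigma$ with $0<\mu(\Omega_i)<\infty$ for all $i\in J$ such that for any $A\in\Sigma$ with $\mu(A)<\infty$ there exist a countable subset $J_0\subset J$ and a set $B$ of zero measure with $A=\bigcup_{i\in J_0}(A\cap\Omega_i)\cup B$. $L_1(\Omega,\Sigma,\mu)$ is the space of all real integrable functions (modulo a.e. equality) with norm $\|f\|=\int_\Omega|f(t)|\,d\mu(t)$.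
   Formalization: The space Z is assumed complete (a Banach space); without this the claim fails, e.g. for finitely supported sequences with the l1-norm, and any Z isometric to an L_1 space is complete anyway. *)

theory Defs
  imports "HOL-Analysis.Analysis"
begin

section \<open>Facially symmetric spaces\<close>

text \<open>
  The real normed space Z is a type \<^typ>\<open>'a\<close> of class \<^class>\<open>real_normed_vector\<close>, and its
  dual is the type \<^typ>\<open>'a \<Rightarrow>\<^sub>L real\<close> with the operator norm.
\<close>

definition geom_orth :: "'a::real_normed_vector \<Rightarrow> 'a \<Rightarrow> bool"  (infix \<open>\<diamond>\<close> 50) where
  "f \<diamond> g \<longleftrightarrow> norm (f + g) = norm f + norm g \<and> norm (f - g) = norm f + norm g"

definition orth_compl :: "'a::real_normed_vector set \<Rightarrow> 'a set" where
  "orth_compl S = {f. \<forall>g\<in>S. f \<diamond> g}"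

definition face :: "('a::real_normed_vector \<Rightarrow>\<^sub>L real) \<Rightarrow> 'a set" where
  "face u = {f. norm f \<le> 1 \<and> blinfun_apply u f = 1}"

definition norm_exposed_face :: "'a::real_normed_vector set \<Rightarrow> bool" where
  "norm_exposed_face F \<longleftrightarrow> F \<noteq> {} \<and> (\<exists>u. norm u = 1 \<and> F = face u)"

definition projective_unit :: "('a::real_normed_vector \<Rightarrow>\<^sub>L real) \<Rightarrow> bool" where
  "projective_unit u \<longleftrightarrow> norm u = 1 \<and> (\<forall>f\<in>orth_compl (face u). blinfun_apply u f = 0)"

definition is_direct_sum :: "'a::real_vector set \<Rightarrow> 'a set \<Rightarrow> 'a set \<Rightarrow> bool" where
  "is_direct_sum V A B \<longleftrightarrow>
     subspace A \<and> subspace B \<and> A \<inter> B = {0} \<and> V = {a + b | a b. a \<in> A \<and> b \<in> B}"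

definition symmetry_of :: "'a::real_normed_vector set \<Rightarrow> ('a \<Rightarrow>\<^sub>L 'a) \<Rightarrow> bool" where
  "symmetry_of F S \<longleftrightarrow>
     (\<forall>f. norm (blinfun_apply S f) = norm f) \<and> surj (blinfun_apply S) \<and>
     S o\<^sub>L S = id_blinfun \<and>
     is_direct_sum {f. blinfun_apply S f = f} (closure (span F)) (orth_compl F)"

definition symmetric_face :: "'a::real_normed_vector set \<Rightarrow> bool" where
  "symmetric_face F \<longleftrightarrow> norm_exposed_face F \<and> (\<exists>S. symmetry_of F S)"

definition weakly_facially_symmetric :: "'a::real_normed_vector itself \<Rightarrow> bool" where
  "weakly_facially_symmetric _ \<longleftrightarrow>
     (\<forall>F :: 'a set. norm_exposed_face F \<longrightarrow> symmetric_face F)"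

text \<open>
  The adjoint of S maps y to \<^term>\<open>y o\<^sub>L S\<close>. A symmetry associated with F is uniquely determined
  by F (two symmetries with the same fixed points differ by a nilpotent N such that all
  I + n N are isometries), so it does not matter that it is quantified universally in some
  definitions below and existentially in others.
\<close>

definition strongly_facially_symmetric :: "'a::real_normed_vector itself \<Rightarrow> bool" where
  "strongly_facially_symmetric Z \<longleftrightarrow> weakly_facially_symmetric Z \<and>
     (\<forall>(F :: 'a set) S y. norm_exposed_face F \<and> symmetry_of F S \<and> norm y = 1 \<and> F \<subseteq> face y
        \<longrightarrow> y o\<^sub>L S = y)"

definition peirce_1 :: "('a::real_normed_vector \<Rightarrow>\<^sub>L 'a) \<Rightarrow> 'a \<Rightarrow>\<^sub>L 'a" where
  "peirce_1 S = (1 / 2) *\<^sub>R (id_blinfun - S)"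

text \<open>
  \<open>peirce_2 F S f\<close> is the component in the closed span of F of the vector f - P1 f = (f + S f) / 2,
  which is a fixed point of S and hence has unique components in the closed span of F and in the
  orthogonal complement of F (the latter being P0 f).
\<close>

definition peirce_2 :: "'a::real_normed_vector set \<Rightarrow> ('a \<Rightarrow>\<^sub>L 'a) \<Rightarrow> 'a \<Rightarrow> 'a" where
  "peirce_2 F S f = (THE a. a \<in> closure (span F) \<and>
     (f - blinfun_apply (peirce_1 S) f) - a \<in> orth_compl F)"

definition contractive_projection :: "('a::real_normed_vector \<Rightarrow> 'a) \<Rightarrow> bool" where
  "contractive_projection Q \<longleftrightarrow>
     linear Q \<and> (\<forall>f. Q (Q f) = Q f) \<and> (\<forall>f. norm (Q f) \<le> norm f)"

definition neutral_projection :: "('a::real_normed_vector \<Rightarrow> 'a) \<Rightarrow> bool" where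
  "neutral_projection Q \<longleftrightarrow>
     contractive_projection Q \<and> (\<forall>f. norm (Q f) = norm f \<longrightarrow> Q f = f)"

definition neutral_space :: "'a::real_normed_vector itself \<Rightarrow> bool" where
  "neutral_space _ \<longleftrightarrow>
     (\<forall>(F :: 'a set) S. symmetric_face F \<and> symmetry_of F S \<longrightarrow> neutral_projection (peirce_2 F S))"

definition geometric_tripotent :: "('a::real_normed_vector \<Rightarrow>\<^sub>L real) \<Rightarrow> bool" where
  "geometric_tripotent u \<longleftrightarrow> projective_unit u \<and> symmetric_face (face u) \<and>
     (\<exists>S. symmetry_of (face u) S \<and> u o\<^sub>L S = u)"

definition unitary_tripotent :: "('a::real_normed_vector \<Rightarrow>\<^sub>L real) \<Rightarrow> bool" where
  "unitary_tripotent e \<longleftrightarrow>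
     geometric_tripotent e \<and> cball 0 1 = convex hull (face e \<union> face (- e))"


section \<open>The space L1 of a measure space\<close>

text \<open>The family in the direct sum property is given by the set of its members.\<close>

definition direct_sum_property :: "'b measure \<Rightarrow> bool" where
  "direct_sum_property M \<longleftrightarrow>
     (\<exists>\<W> \<subseteq> sets M. (\<forall>W\<in>\<W>. 0 < emeasure M W \<and> emeasure M W < \<infinity>) \<and>
        (\<forall>A\<in>sets M. emeasure M A < \<infinity> \<longrightarrow>
           (\<exists>\<W>\<^sub>0 \<subseteq> \<W>. countable \<W>\<^sub>0 \<and>
              (\<exists>B\<in>null_sets M. A = (\<Union>W\<in>\<W>\<^sub>0. A \<inter> W) \<union> B))))"

definition L1_rel :: "'b measure \<Rightarrow> (('b \<Rightarrow> real) \<times> ('b \<Rightarrow> real)) set" where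
  "L1_rel M = {(f, g). integrable M f \<and> integrable M g \<and> (AE x in M. f x = g x)}"

definition L1_space :: "'b measure \<Rightarrow> ('b \<Rightarrow> real) set set" where
  "L1_space M = {f. integrable M f} // L1_rel M"

definition L1_class :: "'b measure \<Rightarrow> ('b \<Rightarrow> real) \<Rightarrow> ('b \<Rightarrow> real) set" where
  "L1_class M f = L1_rel M `` {f}"

text \<open>
  The operations on equivalence classes are lifted from representatives; the lemmas below state
  that they do not depend on the choice of representatives.
\<close>

definition L1_add :: "'b measure \<Rightarrow> ('b \<Rightarrow> real) set \<Rightarrow> ('b \<Rightarrow> real) set \<Rightarrow> ('b \<Rightarrow> real) set" where
  "L1_add M X Y = (\<Union>f\<in>X. \<Union>g\<in>Y. L1_class M (\<lambda>x. f x + g x))"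

definition L1_scale :: "'b measure \<Rightarrow> real \<Rightarrow> ('b \<Rightarrow> real) set \<Rightarrow> ('b \<Rightarrow> real) set" where
  "L1_scale M c X = (\<Union>f\<in>X. L1_class M (\<lambda>x. c * f x))"

definition L1_norm :: "'b measure \<Rightarrow> ('b \<Rightarrow> real) set \<Rightarrow> real" where
  "L1_norm M X = the_elem ((\<lambda>f. LINT x|M. \<bar>f x\<bar>) ` X)"

lemma equiv_L1_rel: "equiv {f. integrable M f} (L1_rel M)"
proof (rule equivI)
  show "sym (L1_rel M)" by (auto simp: L1_rel_def sym_def elim!: AE_mp)
  show "trans (L1_rel M)" by (auto simp: L1_rel_def trans_def elim!: AE_mp)
qed (auto simp: L1_rel_def refl_on_def)

lemma L1_class_eq: "(f, g) \<in> L1_rel M \<Longrightarrow> L1_class M f = L1_class M g"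
  unfolding L1_class_def by (rule equiv_class_eq[OF equiv_L1_rel])

lemma L1_class_self: "integrable M f \<Longrightarrow> f \<in> L1_class M f"
  by (simp add: L1_class_def L1_rel_def)

lemma L1_space_eq: "L1_space M = L1_class M ` {f. integrable M f}"
  by (auto simp: L1_space_def L1_class_def quotient_def)

lemma L1_add_class:
  assumes "integrable M f" "integrable M g"
  shows "L1_add M (L1_class M f) (L1_class M g) = L1_class M (\<lambda>x. f x + g x)"
proof -
  have "L1_class M (\<lambda>x. f' x + g' x) = L1_class M (\<lambda>x. f x + g x)"
    if "f' \<in> L1_class M f" "g' \<in> L1_class M g" for f' g'
    using that by (intro L1_class_eq) (auto simp: L1_class_def L1_rel_def)
  then show ?thesis
    using L1_class_self[OF assms(1)] L1_class_self[OF assms(2)] unfolding L1_add_def by blast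
qed

lemma L1_scale_class:
  assumes "integrable M f"
  shows "L1_scale M c (L1_class M f) = L1_class M (\<lambda>x. c * f x)"
proof -
  have "L1_class M (\<lambda>x. c * f' x) = L1_class M (\<lambda>x. c * f x)" if "f' \<in> L1_class M f" for f'
  proof (rule L1_class_eq)
    have "AE x in M. f' x = f x" using that by (auto simp: L1_class_def L1_rel_def)
    then have "AE x in M. c * f' x = c * f x" by eventually_elim simp
    then show "(\<lambda>x. c * f' x, \<lambda>x. c * f x) \<in> L1_rel M"
      using that by (auto simp: L1_class_def L1_rel_def)
  qed
  then show ?thesis
    using L1_class_self[OF assms] unfolding L1_scale_def by blast
qed

lemma L1_norm_class:
  assumes "integrable M f"
  shows "L1_norm M (L1_class M f) = (LINT x|M. \<bar>f x\<bar>)"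
proof -
  have "(LINT x|M. \<bar>f' x\<bar>) = (LINT x|M. \<bar>f x\<bar>)" if "f' \<in> L1_class M f" for f'
    using that by (intro integral_cong_AE) (auto simp: L1_class_def L1_rel_def)
  then have "(\<lambda>f. LINT x|M. \<bar>f x\<bar>) ` L1_class M f = {LINT x|M. \<bar>f x\<bar>}"
    using L1_class_self[OF assms] by blast
  then show ?thesis by (simp add: L1_norm_def)
qed

definition L1_isometric_isomorphism ::
    "'b measure \<Rightarrow> ('a::real_normed_vector \<Rightarrow> ('b \<Rightarrow> real) set) \<Rightarrow> bool" where
  "L1_isometric_isomorphism M T \<longleftrightarrow>
     bij_betw T UNIV (L1_space M) \<and>
     (\<forall>f g. T (f + g) = L1_add M (T f) (T g)) \<and>
     (\<forall>c f. T (c *\<^sub>R f) = L1_scale M c (T f)) \<and>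
     (\<forall>f. L1_norm M (T f) = norm f)"

text \<open>
  Two conventions of the main statement. First, Z is a Banach space: the space L1 is complete,
  and the finitely supported real sequences with the l1-norm are an incomplete space that satisfies
  all the other hypotheses. Second, HOL cannot quantify existentially over types, so the points of
  the measure space are taken from a type built from Z, namely \<^typ>\<open>'a \<times> 'a set\<close>; it has room
  for a disjoint union, indexed by elements of Z, of Stone spaces of Boolean algebras of
  elements of Z.
\<close>

end

theory Submission imports Defs
begin

text \<open>
  The unitary tripotent \<open>e\<close> defines a cone, \<open>pos_cone e\<close>: the vectors on which \<open>e\<close> attains
  their norm. Since the unit ball is the convex hull of \<open>face e\<close> and its negative, every vector is
  a difference \<open>f1 - f2\<close> of two vectors of the cone with \<open>norm f = norm f1 + norm f2\<close>
  (\<open>positive_decomposition\<close>). What separates L1 from, say, the self-adjoint trace class operators is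
  that such a decomposition is cut out by a band projection, that is, by a linear projection \<open>P\<close>
  such that \<open>P\<close> and \<open>I - P\<close> are both positive. This is \<open>split_by_band_projection\<close>, the only place where
  facial symmetry and neutrality enter; afterwards the proof is a version of Kakutani's
  representation of abstract L-spaces.

  The band projections come from norm exposed faces \<open>F\<close> contained in \<open>face e\<close>. Strong facial symmetry
  makes the symmetry \<open>S\<close> of such a face positive, and neutrality makes the Peirce projections \<open>P2\<close>
  and \<open>P0\<close> positive (\<open>components_pos\<close>). The functional \<open>e \<circ> (P2 - P0)\<close> exposes another face, which
  has the same symmetry \<open>S\<close> and whose Peirce 2-projection is \<open>(I + S) / 2\<close>; as \<open>(I + S) / 2\<close>
  preserves the norm of positive vectors, neutrality of that projection forces \<open>S = I\<close>
  (\<open>S_eq_id\<close>). So the Peirce 1-part vanishes and \<open>P2\<close> is a band projection. For \<open>f = f1 - f2\<close>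
  as above, a support functional \<open>u\<close> of \<open>f\<close> separates \<open>f1\<close> from \<open>f2\<close>, and the face of
  \<open>(e + u) / 2\<close> yields a band projection that maps \<open>f\<close> to \<open>f1\<close>.

  For the representation, take a maximal family \<open>J\<close> of pairwise disjoint positive unit vectors. The
  components \<open>P x\<close> of a fixed \<open>x \<in> J\<close>, with \<open>P\<close> a band projection, form a Boolean algebra; on its
  Stone space the clopen sets carry the finitely additive measure \<open>norm (P x)\<close>, which extends to a
  measure by compactness and Caratheodory's theorem (\<open>stone_measure_exists\<close>). The measure space is
  the disjoint sum of these spaces over \<open>J\<close>, so it has the direct sum property. Sending \<open>P x\<close>
  to the indicator of the corresponding clopen set preserves norms of linear combinations
  (\<open>integral_abs_step\<close>). Combinations of components are dense in \<open>Z\<close> (\<open>components_dense\<close>), step functions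
  over clopen sets are dense in L1 (\<open>representable_integrable\<close>), and both spaces are complete, so the
  closure of the graph is the graph of an isometric isomorphism (\<open>L1_representation\<close>).
\<close>

section \<open>Support functionals\<close>

definition sublinear :: "('a::real_vector \<Rightarrow> real) \<Rightarrow> bool" where
  "sublinear p \<longleftrightarrow> (\<forall>x y. p (x + y) \<le> p x + p y) \<and> (\<forall>c x. c > 0 \<longrightarrow> p (c *\<^sub>R x) \<le> c * p x)"

lemma sublinear_scale:
  assumes "sublinear p" "c \<ge> 0" shows "p (c *\<^sub>R x) = c * p x"
proof -
  have h: "p (c *\<^sub>R x) \<le> c * p x" if "c > 0" for c x
    using assms(1) that by (auto simp: sublinear_def)
  have "p 0 = 0" using h[of 2 0] h[of "1/2" 0] by simp
  moreover have "c * p x \<le> p (c *\<^sub>R x)" if "c > 0"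
    using h[of "inverse c" "c *\<^sub>R x"] that by (simp add: field_simps)
  ultimately show ?thesis using h[of c x] assms(2) by (cases "c = 0") auto
qed

lemma sublinear_ge_minus:
  assumes "sublinear p" shows "- p (- x) \<le> p x"
proof -
  have "p (x + - x) \<le> p x + p (- x)" using assms unfolding sublinear_def by blast
  then show ?thesis using sublinear_scale[OF assms, of 0 0] by simp
qed

text \<open>
  This is the largest sublinear functional that lies below \<open>p\<close> and is at most \<open>- p f\<close> at \<open>- f\<close>.
\<close>

definition tilt :: "('a::real_vector \<Rightarrow> real) \<Rightarrow> 'a \<Rightarrow> 'a \<Rightarrow> real" where
  "tilt p f x = (INF t\<in>{0..}. p (x + t *\<^sub>R f) - t * p f)"

lemma tilt_props:
  assumes p: "sublinear p"
  shows "sublinear (tilt p f)" and "tilt p f x \<le> p x" and "tilt p f (- f) \<le> - p f"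
proof -
  have add: "p (x + y) \<le> p x + p y" for x y using p by (auto simp: sublinear_def)
  have "- p (- x) \<le> p (x + t *\<^sub>R f) - t * p f" if "t \<ge> 0" for t x
    using add[of "x + t *\<^sub>R f" "- x"] sublinear_scale[OF p that, of f] by simp
  then have bdd: "bdd_below ((\<lambda>t. p (x + t *\<^sub>R f) - t * p f) ` {0..})" for x
    by (intro bdd_belowI2[where m = "- p (- x)"]) auto
  have le: "tilt p f x \<le> p (x + t *\<^sub>R f) - t * p f" if "t \<ge> 0" for t x
    unfolding tilt_def using bdd that by (intro cINF_lower) auto
  show "tilt p f x \<le> p x" using le[of 0 x] by simp
  show "tilt p f (- f) \<le> - p f"
    using le[of 1 "- f"] sublinear_scale[OF p, of 0 0] by simp
  have sum: "tilt p f (x + y) \<le> tilt p f x + tilt p f y" for x y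
  proof -
    have st: "tilt p f (x + y) \<le> (p (x + t *\<^sub>R f) - t * p f) + (p (y + s *\<^sub>R f) - s * p f)"
      if "t \<ge> 0" "s \<ge> 0" for s t
      using le[of "t + s" "x + y"] add[of "x + t *\<^sub>R f" "y + s *\<^sub>R f"] that
      by (simp add: algebra_simps)
    have "tilt p f (x + y) - (p (x + t *\<^sub>R f) - t * p f) \<le> tilt p f y" if "t \<ge> 0" for t
      unfolding tilt_def[of _ _ y] using st[OF that] by (intro cINF_greatest) (auto simp: algebra_simps)
    then have "tilt p f (x + y) - tilt p f y \<le> tilt p f x"
      unfolding tilt_def[of _ _ x] by (intro cINF_greatest) (auto simp: algebra_simps)
    then show ?thesis by simp
  qed
  have "tilt p f (c *\<^sub>R x) \<le> c * tilt p f x" if c: "c > 0" for c x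
  proof -
    have "tilt p f (c *\<^sub>R x) / c \<le> tilt p f x"
      unfolding tilt_def[of _ _ x]
    proof (intro cINF_greatest)
      fix t :: real assume "t \<in> {0..}"
      then have t: "t \<ge> 0" by simp
      have "p (c *\<^sub>R x + (c * t) *\<^sub>R f) = c * p (x + t *\<^sub>R f)"
        using sublinear_scale[OF p, of c "x + t *\<^sub>R f"] c by (simp add: scaleR_add_right)
      then have "tilt p f (c *\<^sub>R x) \<le> c * (p (x + t *\<^sub>R f) - t * p f)"
        using le[of "c * t" "c *\<^sub>R x"] c t by (simp add: algebra_simps)
      then show "tilt p f (c *\<^sub>R x) / c \<le> p (x + t *\<^sub>R f) - t * p f"
        using c by (simp add: field_simps)
    qed auto
    then show ?thesis using c by (simp add: field_simps)
  qed
  with sum show "sublinear (tilt p f)" by (simp add: sublinear_def)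
qed

text \<open>
  By Zorn's lemma there is a minimal sublinear functional below \<open>p\<close>. Tilting cannot make it smaller,
  which turns out to mean that it is odd, and an odd sublinear functional is linear. The pointwise
  infimum of a chain is subadditive because the values at two different points can be compared with
  those of one common member of the chain.
\<close>

lemma linear_below_sublinear:
  assumes p: "sublinear (p :: 'a::real_vector \<Rightarrow> real)"
  shows "\<exists>m. linear m \<and> (\<forall>x. m x \<le> p x)"
proof -
  define A where "A = {q. sublinear q \<and> (\<forall>x. q x \<le> p x)}"
  have "\<exists>m\<in>A. \<forall>q\<in>A. (\<forall>x. q x \<le> m x) \<longrightarrow> q = m"
  proof (rule predicate_Zorn[where P = "\<lambda>m q. \<forall>x. q x \<le> m x"])
    show "partial_order_on A (relation_of (\<lambda>m q. \<forall>x. q x \<le> m x) A)"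
      by (rule partial_order_on_relation_ofI) (auto intro: order_trans simp: order_antisym ext)
  next
    fix C assume C: "C \<in> Chains (relation_of (\<lambda>m q. \<forall>x. q x \<le> m x) A)"
    have CA: "C \<subseteq> A" using Chains_relation_of[OF C] .
    have chain: "(\<forall>x. q x \<le> r x) \<or> (\<forall>x. r x \<le> q x)" if "q \<in> C" "r \<in> C" for q r
      using C that by (auto simp: Chains_def relation_of_def)
    show "\<exists>u\<in>A. \<forall>q\<in>C. \<forall>x. u x \<le> q x"
    proof (cases "C = {}")
      case True
      then show ?thesis using p by (auto simp: A_def)
    next
      case False
      have "- p (- x) \<le> q x" if "q \<in> C" for q x
      proof -
        have "sublinear q" "q (- x) \<le> p (- x)" using that CA by (auto simp: A_def)
        then show ?thesis using sublinear_ge_minus[of q x] by simp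
      qed
      then have bdd: "bdd_below ((\<lambda>q. q x) ` C)" for x
        by (intro bdd_belowI2[where m = "- p (- x)"]) auto
      define u where "u x = (INF q\<in>C. q x)" for x
      have le: "u x \<le> q x" if "q \<in> C" for q x
        unfolding u_def using bdd that by (intro cINF_lower)
      have sum: "u (x + y) \<le> u x + u y" for x y
      proof -
        have st: "u (x + y) \<le> q x + r y" if q: "q \<in> C" and r: "r \<in> C" for q r
        proof -
          have qa: "q (x + y) \<le> q x + q y" and ra: "r (x + y) \<le> r x + r y"
            using q r CA by (auto simp: A_def sublinear_def)
          from chain[OF q r] show ?thesis
          proof
            assume "\<forall>x. q x \<le> r x"
            then have "q y \<le> r y" by blast
            then show ?thesis using qa le[OF q, of "x + y"] by linarith
          next
            assume "\<forall>x. r x \<le> q x"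
            then have "r x \<le> q x" by blast
            then show ?thesis using ra le[OF r, of "x + y"] by linarith
          qed
        qed
        have "u (x + y) - q x \<le> u y" if "q \<in> C" for q
          unfolding u_def[of y] using False st[OF that]
          by (intro cINF_greatest) (auto simp: algebra_simps)
        then have "u (x + y) - u y \<le> u x"
          unfolding u_def[of x] using False by (intro cINF_greatest) (auto simp: algebra_simps)
        then show ?thesis by simp
      qed
      have scale: "u (c *\<^sub>R x) \<le> c * u x" if c: "c > 0" for c x
      proof -
        have "u (c *\<^sub>R x) / c \<le> u x"
          unfolding u_def[of x]
        proof (intro cINF_greatest False)
          fix q assume q: "q \<in> C"
          have "q (c *\<^sub>R x) \<le> c * q x" using q CA c by (auto simp: A_def sublinear_def)
          then show "u (c *\<^sub>R x) / c \<le> q x"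
            using le[OF q, of "c *\<^sub>R x"] c by (simp add: field_simps)
        qed
        then show ?thesis using c by (simp add: field_simps)
      qed
      obtain q where "q \<in> C" using False by blast
      then have "q x \<le> p x" "u x \<le> q x" for x using le[of q x] CA by (auto simp: A_def)
      then have "u x \<le> p x" for x by (rule order_trans[rotated])
      with sum scale have "u \<in> A" by (auto simp: A_def sublinear_def)
      with le show ?thesis by blast
    qed
  qed
  then obtain m where mA: "m \<in> A" and min: "\<And>q. q \<in> A \<Longrightarrow> (\<And>x. q x \<le> m x) \<Longrightarrow> q = m" by blast
  have m: "sublinear m" and mp: "\<And>x. m x \<le> p x" using mA by (auto simp: A_def)
  \<comment> \<open>Tilting a minimal functional does not change it, hence it is odd.\<close>
  have odd: "m (- f) = - m f" for f
  proof -
    have "tilt m f x \<le> p x" for x by (rule order_trans[OF tilt_props(2)[OF m] mp])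
    then have "tilt m f \<in> A" using tilt_props(1)[OF m] by (simp add: A_def)
    then have "tilt m f = m" using min tilt_props(2)[OF m] by blast
    then have "m (- f) \<le> - m f" using tilt_props(3)[OF m, of f] by simp
    then show ?thesis using sublinear_ge_minus[OF m, of f] by simp
  qed
  have "linear m"
  proof (rule linearI)
    have sub: "m (x + y) \<le> m x + m y" for x y using m by (auto simp: sublinear_def)
    show "m (x + y) = m x + m y" for x y
      using sub[of x y] sub[of "- x" "- y"] odd[of "x + y"] odd[of x] odd[of y] by simp
    show "m (c *\<^sub>R x) = c *\<^sub>R m x" for c x
    proof (cases "c \<ge> 0")
      case True
      then show ?thesis using sublinear_scale[OF m] by simp
    next
      case False
      then have "m ((- c) *\<^sub>R x) = (- c) * m x" by (intro sublinear_scale[OF m]) simp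
      then show ?thesis using odd[of "c *\<^sub>R x"] by simp
    qed
  qed
  with mp show ?thesis by blast
qed

text \<open>
  A linear functional below the norm has norm at most 1; tilting the norm in direction \<open>f\<close> first forces
  the value at \<open>f\<close> to be \<open>norm f\<close>.
\<close>

lemma support_functional_exists:
  fixes f :: "'a::real_normed_vector"
  obtains u :: "'a \<Rightarrow>\<^sub>L real" where "norm u \<le> 1" "blinfun_apply u f = norm f"
proof -
  have n: "sublinear (norm :: 'a \<Rightarrow> real)" by (auto simp: sublinear_def norm_triangle_ineq)
  obtain m where m: "linear m" and le: "\<And>x. m x \<le> tilt norm f x"
    using linear_below_sublinear[OF tilt_props(1)[OF n]] by blast
  have mn: "m x \<le> norm x" for x using le tilt_props(2)[OF n] order_trans by blast
  have abs: "\<bar>m x\<bar> \<le> norm x" for x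
    using mn[of x] mn[of "- x"] linear_neg[OF m, of x] by auto
  have bl: "bounded_linear m"
    using m abs by (intro bounded_linear.intro bounded_linear_axioms.intro exI[of _ 1]) auto
  show thesis
  proof
    show "norm (Blinfun m) \<le> 1"
      using abs by (intro norm_blinfun_bound) (auto simp: bounded_linear_Blinfun_apply[OF bl])
    have "m (- f) \<le> - norm f" using le[of "- f"] tilt_props(3)[OF n, of f] by simp
    then show "blinfun_apply (Blinfun m) f = norm f"
      using linear_neg[OF m, of f] mn[of f] by (simp add: bounded_linear_Blinfun_apply[OF bl])
  qed
qed

section \<open>Norm exposed faces and their symmetries\<close>

text \<open>
  For a unitary tripotent \<open>e\<close> this is the cone generated by \<open>face e\<close>. Every order-theoretic notion below
  refers to this cone: \<open>f\<close> lies below \<open>g\<close> if \<open>g - f\<close> is in the cone.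
\<close>

definition pos_cone :: "('a::real_normed_vector \<Rightarrow>\<^sub>L real) \<Rightarrow> 'a set" where
  "pos_cone e = {f. e f = norm f}"

text \<open>
  In a vector lattice these are exactly the projections onto projection bands, but the definition makes
  sense for any cone, so that no lattice operations have to be constructed.
\<close>

definition band_projection :: "('a::real_normed_vector \<Rightarrow>\<^sub>L real) \<Rightarrow> ('a \<Rightarrow> 'a) \<Rightarrow> bool" where
  "band_projection e P \<longleftrightarrow> linear P \<and> (\<forall>f. P (P f) = P f) \<and>
     (\<forall>f\<in>pos_cone e. P f \<in> pos_cone e \<and> f - P f \<in> pos_cone e)"

lemma blinfun_abs_le: 
  fixes u :: "'a::real_normed_vector \<Rightarrow>\<^sub>L real"
  assumes "norm u \<le> 1" shows "\<bar>u f\<bar> \<le> norm f"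
  using norm_blinfun[of u f] assms mult_right_mono[of "norm u" 1 "norm f"] by simp

lemma pos_cone_scale:
  assumes "f \<in> pos_cone e" "c \<ge> 0" shows "c *\<^sub>R f \<in> pos_cone e"
  using assms by (simp add: pos_cone_def blinfun.scaleR_right)

lemma pos_cone_add:
  assumes "norm e \<le> 1" "f \<in> pos_cone e" "g \<in> pos_cone e"
  shows "f + g \<in> pos_cone e" and "norm (f + g) = norm f + norm g"
proof -
  have "e (f + g) = norm f + norm g" using assms by (simp add: pos_cone_def blinfun.add_right)
  then show "f + g \<in> pos_cone e" "norm (f + g) = norm f + norm g"
    using blinfun_abs_le[OF assms(1), of "f + g"] norm_triangle_ineq[of f g]
    by (auto simp: pos_cone_def)
qed

lemma zero_in_pos_cone [simp]: "0 \<in> pos_cone e"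
  by (simp add: pos_cone_def)

lemma faceD:
  fixes u :: "'a::real_normed_vector \<Rightarrow>\<^sub>L real"
  assumes "norm u \<le> 1" "g \<in> face u" shows "norm g = 1" "u g = 1"
  using blinfun_abs_le[OF assms(1), of g] assms(2) by (auto simp: face_def)

lemma norm_eq_1_of_face:
  fixes u :: "'a::real_normed_vector \<Rightarrow>\<^sub>L real"
  assumes "norm u \<le> 1" "face u \<noteq> {}" shows "norm u = 1"
proof -
  obtain g where g: "g \<in> face u" using assms(2) by blast
  have "1 \<le> norm u" using norm_blinfun[of u g] faceD[OF assms(1) g] by simp
  then show ?thesis using assms(1) by simp
qed

lemma face_midpoint:
  fixes u v :: "'a::real_normed_vector \<Rightarrow>\<^sub>L real"
  assumes "norm u \<le> 1" "norm v \<le> 1"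
  shows "face ((1/2) *\<^sub>R (u + v)) = face u \<inter> face v"
    and "norm ((1/2) *\<^sub>R (u + v)) \<le> 1"
proof -
  show "norm ((1/2) *\<^sub>R (u + v)) \<le> 1" using norm_triangle_ineq[of u v] assms by simp
  have "f \<in> face ((1/2) *\<^sub>R (u + v)) \<longleftrightarrow> norm f \<le> 1 \<and> u f + v f = 2" for f
    by (auto simp: face_def blinfun.scaleR_left blinfun.add_left)
  moreover have "norm f \<le> 1 \<and> u f + v f = 2 \<longleftrightarrow> norm f \<le> 1 \<and> u f = 1 \<and> v f = 1" for f
    using blinfun_abs_le[OF assms(1), of f] blinfun_abs_le[OF assms(2), of f] by linarith
  ultimately show "face ((1/2) *\<^sub>R (u + v)) = face u \<inter> face v"
    by (auto simp: face_def)
qed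

lemma norm_exposed_faceI:
  assumes "norm u \<le> 1" "face u \<noteq> {}" shows "norm_exposed_face (face u)"
  using assms norm_eq_1_of_face[OF assms] by (auto simp: norm_exposed_face_def)

lemma face_scaled:
  fixes u :: "'a::real_normed_vector \<Rightarrow>\<^sub>L real"
  assumes "a \<noteq> 0" "u a = norm a" shows "(1 / norm a) *\<^sub>R a \<in> face u"
  using assms by (simp add: face_def blinfun.scaleR_right)

lemma orth_sym: "f \<diamond> g \<longleftrightarrow> g \<diamond> f"
  by (auto simp: geom_orth_def add.commute norm_minus_commute)

text \<open>
  The vector \<open>n = S f - T f\<close> is fixed by \<open>S\<close> and by \<open>T\<close>, and the isometry \<open>S \<circ> T\<close> maps \<open>f + (k + 1) n\<close>
  to \<open>f + k n\<close>. So all the vectors \<open>f + k n\<close> have the same norm, which is possible only if \<open>n = 0\<close>.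
\<close>

lemma symmetry_unique:
  fixes S T :: "'a::real_normed_vector \<Rightarrow>\<^sub>L 'a"
  assumes S: "S o\<^sub>L S = id_blinfun" "\<And>f. norm (S f) = norm f"
    and T: "T o\<^sub>L T = id_blinfun" "\<And>f. norm (T f) = norm f"
    and same: "{f. S f = f} = {f. T f = f}"
  shows "S = T"
proof (rule blinfun_eqI)
  fix f
  have SS: "S (S f) = f" for f
    using arg_cong[OF S(1), of "\<lambda>U. blinfun_apply U f"] by simp
  have TT: "T (T f) = f" for f
    using arg_cong[OF T(1), of "\<lambda>U. blinfun_apply U f"] by simp
  define n where "n = S f - T f"
  have "S (f + S f) = f + S f" "T (f + T f) = f + T f"
    by (simp_all add: blinfun.add_right SS TT)
  then have a: "T (f + S f) = f + S f" "S (f + T f) = f + T f" using same by blast+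
  have "T (f + S f - (f + T f)) = f + S f - (f + T f)"
    using a(1) by (simp only: blinfun.diff_right a(1)) (simp add: blinfun.add_right TT)
  then have Tn: "T n = n" by (simp add: n_def)
  then have Sn: "S n = n" using same by blast
  have "S (T f) = f + T f - S f" using a(2) by (simp add: blinfun.add_right algebra_simps)
  then have STf: "S (T f) = f - n" by (simp add: n_def)
  have "norm (f + real k *\<^sub>R n) = norm f" for k
  proof (induction k)
    case (Suc k)
    have "S (T (f + real (Suc k) *\<^sub>R n)) = f - n + real (Suc k) *\<^sub>R n"
      by (simp add: blinfun.add_right blinfun.scaleR_right Tn Sn STf)
    also have "\<dots> = f + real k *\<^sub>R n" by (simp add: algebra_simps)
    finally show ?case using Suc S(2) T(2) by metis
  qed simp
  then have "real k * norm n \<le> 2 * norm f" for k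
    using norm_triangle_ineq4[of "f + real k *\<^sub>R n" f] by simp
  then have "\<not> norm n > 0"
    using reals_Archimedean3[of "norm n"] not_le by blast
  then show "S f = T f" by (simp add: n_def)
qed

lemma symmetry_fix:
  assumes "symmetry_of F S" "a \<in> closure (span F)" "b \<in> orth_compl F"
  shows "S (a + b) = a + b"
  using assms by (auto simp: symmetry_of_def is_direct_sum_def set_eq_iff)

lemma symmetry_fixE:
  assumes "symmetry_of F S" "S f = f"
  obtains a b where "f = a + b" "a \<in> closure (span F)" "b \<in> orth_compl F"
proof -
  have "{f. S f = f} = {a + b | a b. a \<in> closure (span F) \<and> b \<in> orth_compl F}"
    using assms(1) by (simp add: symmetry_of_def is_direct_sum_def)
  moreover have "f \<in> {f. S f = f}" using assms(2) by simp
  ultimately have "f \<in> {a + b | a b. a \<in> closure (span F) \<and> b \<in> orth_compl F}" by (simp only:)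
  then show thesis using that by blast
qed

lemma symmetry_subspaces:
  assumes "symmetry_of F S"
  shows "subspace (closure (span F))" "subspace (orth_compl F)"
    "closure (span F) \<inter> orth_compl F = {0}"
  using assms by (auto simp: symmetry_of_def is_direct_sum_def)

lemma symmetry_involution:
  assumes "symmetry_of F S" shows "S (S f) = f"
proof -
  have "S o\<^sub>L S = id_blinfun" using assms by (simp add: symmetry_of_def)
  from arg_cong[OF this, of "\<lambda>U. blinfun_apply U f"] show ?thesis by simp
qed

lemma peirce_2_eqI:
  assumes S: "symmetry_of F S" and a: "a \<in> closure (span F)"
    and b: "(1/2) *\<^sub>R (f + S f) - a \<in> orth_compl F"
  shows "peirce_2 F S f = a"
proof -
  have *: "f - peirce_1 S f = (1/2) *\<^sub>R (f + S f)"
    by (simp add: peirce_1_def blinfun.scaleR_left blinfun.diff_left algebra_simps flip: scaleR_2)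
  show ?thesis
    unfolding peirce_2_def *
  proof (rule the_equality)
    fix a' assume a': "a' \<in> closure (span F) \<and> (1/2) *\<^sub>R (f + S f) - a' \<in> orth_compl F"
    have "a' - a \<in> closure (span F)"
      using a a' symmetry_subspaces(1)[OF S] by (auto intro: subspace_diff)
    moreover have "((1/2) *\<^sub>R (f + S f) - a) - ((1/2) *\<^sub>R (f + S f) - a') \<in> orth_compl F"
      using b a' symmetry_subspaces(2)[OF S] by (blast intro: subspace_diff)
    then have "a' - a \<in> orth_compl F" by simp
    ultimately have "a' - a \<in> {0}" using symmetry_subspaces(3)[OF S] by blast
    then show "a' = a" by simp
  qed (use a b in auto)
qed

lemma peirce_2_mem:
  assumes S: "symmetry_of F S"
  shows "peirce_2 F S f \<in> closure (span F)"
    and "(1/2) *\<^sub>R (f + S f) - peirce_2 F S f \<in> orth_compl F"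
proof -
  have "S ((1/2) *\<^sub>R (f + S f)) = (1/2) *\<^sub>R (f + S f)"
    by (simp add: blinfun.add_right blinfun.scaleR_right symmetry_involution[OF S] add.commute)
  then obtain a b where ab: "(1/2) *\<^sub>R (f + S f) = a + b" "a \<in> closure (span F)" "b \<in> orth_compl F"
    by (rule symmetry_fixE[OF S])
  then have "(1/2) *\<^sub>R (f + S f) - a \<in> orth_compl F" by simp
  from peirce_2_eqI[OF S ab(2) this] this ab(2)
  show "peirce_2 F S f \<in> closure (span F)"
    and "(1/2) *\<^sub>R (f + S f) - peirce_2 F S f \<in> orth_compl F" by auto
qed

locale unitary_sfs =
  fixes e :: "'a::banach \<Rightarrow>\<^sub>L real"
  assumes neutral: "neutral_space TYPE('a)"
    and sfs: "strongly_facially_symmetric TYPE('a)"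
    and unitary: "unitary_tripotent e"
begin

abbreviation C where "C \<equiv> pos_cone e"

lemma norm_e: "norm e = 1"
  using unitary by (simp add: unitary_tripotent_def geometric_tripotent_def projective_unit_def)

lemma e_abs_le: "\<bar>e f\<bar> \<le> norm f"
  using blinfun_abs_le[of e f] norm_e by simp

lemmas C_add = pos_cone_add[of e, OF eq_refl[OF norm_e]]

lemma symmetry_exists:
  fixes F :: "'a set"
  assumes "norm_exposed_face F"
  obtains S where "symmetry_of F S" "neutral_projection (peirce_2 F S)"
proof -
  have "symmetric_face F"
    using sfs assms by (auto simp: strongly_facially_symmetric_def weakly_facially_symmetric_def)
  with neutral that show thesis by (auto simp: neutral_space_def symmetric_face_def)
qed

text \<open>
  The differences \<open>f1 - f2\<close> of positive vectors with \<open>e (f1 + f2) \<le> 1\<close> form a convex set that contains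
  \<open>face e\<close> and its negative, hence the whole unit ball.
\<close>

lemma positive_decomposition:
  obtains f1 f2 where "f1 \<in> C" "f2 \<in> C" "f = f1 - f2" "norm f = norm f1 + norm f2"
proof (cases "f = 0")
  case True
  then show thesis using that[of 0 0] by simp
next
  case False
  define D where "D = {f1 - f2 | f1 f2. f1 \<in> C \<and> f2 \<in> C \<and> e (f1 + f2) \<le> 1}"
  have "convex D"
    unfolding convex_def
  proof (intro ballI allI impI)
    fix x y and u v :: real
    assume "x \<in> D" "y \<in> D" and uv: "0 \<le> u" "0 \<le> v" "u + v = 1"
    then obtain x1 x2 y1 y2 where x: "x = x1 - x2" "x1 \<in> C" "x2 \<in> C" "e (x1 + x2) \<le> 1"
      and y: "y = y1 - y2" "y1 \<in> C" "y2 \<in> C" "e (y1 + y2) \<le> 1"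
      unfolding D_def by blast
    have "e ((u *\<^sub>R x1 + v *\<^sub>R y1) + (u *\<^sub>R x2 + v *\<^sub>R y2)) = u * e (x1 + x2) + v * e (y1 + y2)"
      by (simp add: blinfun.add_right blinfun.scaleR_right algebra_simps)
    also have "\<dots> \<le> 1" using convex_bound_le[OF x(4) y(4) uv] by simp
    finally have "e ((u *\<^sub>R x1 + v *\<^sub>R y1) + (u *\<^sub>R x2 + v *\<^sub>R y2)) \<le> 1" .
    moreover have "u *\<^sub>R x1 + v *\<^sub>R y1 \<in> C" "u *\<^sub>R x2 + v *\<^sub>R y2 \<in> C"
      using x y uv by (auto intro!: C_add pos_cone_scale)
    moreover have "u *\<^sub>R x + v *\<^sub>R y = (u *\<^sub>R x1 + v *\<^sub>R y1) - (u *\<^sub>R x2 + v *\<^sub>R y2)"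
      by (simp add: x y algebra_simps)
    ultimately show "u *\<^sub>R x + v *\<^sub>R y \<in> D" unfolding D_def by blast
  qed
  moreover have "face e \<union> face (- e) \<subseteq> D"
  proof
    fix g assume "g \<in> face e \<union> face (- e)"
    then consider "g \<in> face e" | "g \<in> face (- e)" by blast
    then show "g \<in> D"
    proof cases
      case 1
      then have "g \<in> C" "e g = 1" using faceD[of e g] norm_e by (auto simp: pos_cone_def)
      then show ?thesis unfolding D_def
        by (intro CollectI exI[of _ g] exI[of _ 0]) auto
    next
      case 2
      then have "- g \<in> C" "e (- g) = 1" 
        using faceD[of "- e" g] norm_e by (auto simp: pos_cone_def blinfun.minus_left blinfun.minus_right)
      then show ?thesis unfolding D_def
        by (intro CollectI exI[of _ 0] exI[of _ "- g"]) auto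
    qed
  qed
  ultimately have "cball 0 1 \<subseteq> D"
    using unitary hull_minimal[of "face e \<union> face (- e)" D convex] by (simp add: unitary_tripotent_def)
  then have "(1 / norm f) *\<^sub>R f \<in> D" using False by auto
  then obtain g1 g2 where g: "(1 / norm f) *\<^sub>R f = g1 - g2" "g1 \<in> C" "g2 \<in> C" "e (g1 + g2) \<le> 1"
    unfolding D_def by blast
  have f: "f = norm f *\<^sub>R g1 - norm f *\<^sub>R g2"
    using False by (simp flip: scaleR_diff_right g(1))
  have "norm g1 + norm g2 \<le> 1" using g by (simp add: blinfun.add_right pos_cone_def)
  then have "norm f * norm g1 + norm f * norm g2 \<le> norm f"
    using mult_left_mono[of "norm g1 + norm g2" 1 "norm f"] by (simp add: distrib_left)
  moreover have "norm f \<le> norm f * norm g1 + norm f * norm g2"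
    using norm_triangle_ineq4[of "norm f *\<^sub>R g1" "norm f *\<^sub>R g2"] f by simp
  ultimately have "norm f = norm (norm f *\<^sub>R g1) + norm (norm f *\<^sub>R g2)" by simp
  with pos_cone_scale[OF g(2) norm_ge_zero] pos_cone_scale[OF g(3) norm_ge_zero] f
  show thesis by (rule that)
qed

lemma orthI:
  fixes u :: "'a \<Rightarrow>\<^sub>L real"
  assumes "f \<in> C" "g \<in> C" "norm u \<le> 1" "u f = norm f" "u g = - norm g"
  shows "f \<diamond> g"
proof -
  have "u (f - g) = norm f + norm g" using assms by (simp add: blinfun.diff_right)
  then have "norm f + norm g \<le> norm (f - g)"
    using blinfun_abs_le[OF assms(3), of "f - g"] by simp
  then show ?thesis
    using C_add(2)[OF assms(1,2)] norm_triangle_ineq4[of f g] by (simp add: geom_orth_def)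
qed

end

section \<open>Band projections from norm exposed faces\<close>

context unitary_sfs
begin

lemma orth_compl_subspace:
  fixes F :: "'a set"
  assumes "norm_exposed_face F" shows "subspace (orth_compl F)"
  using symmetry_exists[OF assms] symmetry_subspaces(2) by metis

text \<open>
  Orthogonality to a face is defined by adding and subtracting its elements themselves. It extends to
  their multiples because the orthogonal complement of a symmetric face is a subspace.
\<close>

lemma norm_add_multiple_orth:
  fixes F :: "'a set"
  assumes F: "norm_exposed_face F" and b: "b \<in> orth_compl F" and g: "g \<in> F" "norm g = 1"
  shows "norm (b + t *\<^sub>R g) = norm b + \<bar>t\<bar>"
proof (cases "t = 0")
  case False
  have "(1 / t) *\<^sub>R b \<in> orth_compl F"
    using orth_compl_subspace[OF F] b by (rule subspace_scale)
  then have "norm ((1 / t) *\<^sub>R b + g) = norm ((1 / t) *\<^sub>R b) + norm g"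
    using g by (auto simp: orth_compl_def geom_orth_def)
  moreover have "norm (b + t *\<^sub>R g) = norm (t *\<^sub>R ((1 / t) *\<^sub>R b + g))"
    using False by (simp add: scaleR_add_right)
  then have "norm (b + t *\<^sub>R g) = \<bar>t\<bar> * norm ((1 / t) *\<^sub>R b + g)"
    by (simp only: norm_scaleR)
  ultimately show ?thesis using g(2) False by (simp add: field_simps)
qed simp

lemma orth_positive_part:
  assumes "f1 \<in> C" "f2 \<in> C" "norm (f1 - f2) = norm f1 + norm f2" "g \<in> C" "f1 - f2 \<diamond> g"
  shows "f1 \<diamond> g"
proof -
  have "norm f1 + norm f2 + norm g = norm (f1 - f2 - g)"
    using assms(3,5) by (simp add: geom_orth_def)
  also have "\<dots> = norm ((f1 - g) - f2)" by (simp add: algebra_simps)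
  also have "\<dots> \<le> norm (f1 - g) + norm f2" by (rule norm_triangle_ineq4)
  finally show ?thesis
    using C_add(2)[OF assms(1,4)] norm_triangle_ineq4[of f1 g] by (simp add: geom_orth_def)
qed

lemma orth_compl_decomposition:
  assumes "F \<subseteq> C" "b \<in> orth_compl F"
  obtains b1 b2 where "b1 \<in> C" "b2 \<in> C" "b1 \<in> orth_compl F" "b2 \<in> orth_compl F"
    "b = b1 - b2" "norm b = norm b1 + norm b2"
proof -
  obtain b1 b2 where b: "b1 \<in> C" "b2 \<in> C" "b = b1 - b2" "norm b = norm b1 + norm b2"
    by (rule positive_decomposition)
  have 1: "b1 \<in> orth_compl F"
    using orth_positive_part[OF b(1,2)] b(3,4) assms by (auto simp: orth_compl_def)
  have neg: "b2 - b1 \<diamond> g" if "b1 - b2 \<diamond> g" for g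
    using that norm_minus_commute[of b1 "b2 + g"] norm_minus_commute[of "b1 + g" b2]
      norm_minus_commute[of b1 b2]
    by (auto simp: geom_orth_def algebra_simps)
  have 2: "b2 \<in> orth_compl F"
    using orth_positive_part[OF b(2,1)] b(3,4) assms neg norm_minus_commute[of b1 b2]
    by (auto simp: orth_compl_def)
  show thesis by (rule that[OF b(1,2) 1 2 b(3,4)])
qed

end

text \<open>
  A norm exposed face inside \<open>face e\<close>, together with its symmetry. The aim is to show that the symmetry
  is the identity and that the Peirce 2-projection is a band projection.
\<close>

locale positive_face = unitary_sfs e for e :: "'a::banach \<Rightarrow>\<^sub>L real" +
  fixes w :: "'a \<Rightarrow>\<^sub>L real" and S :: "'a \<Rightarrow>\<^sub>L 'a"
  assumes norm_w: "norm w \<le> 1" and ne: "face w \<noteq> {}" and sub: "face w \<subseteq> face e"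
    and S: "symmetry_of (face w) S" and neutral_P2: "neutral_projection (peirce_2 (face w) S)"
begin

abbreviation F where "F \<equiv> face w"
abbreviation V where "V \<equiv> closure (span (face w))"
abbreviation P2 where "P2 \<equiv> peirce_2 (face w) S"

definition R where "R f = (1/2) *\<^sub>R (f + S f)"
definition P0 where "P0 f = R f - P2 f"

lemma F_exposed: "norm_exposed_face F"
  using norm_w ne by (rule norm_exposed_faceI)

lemma F_pos: "g \<in> F \<Longrightarrow> g \<in> C" and F_norm: "g \<in> F \<Longrightarrow> norm g = 1"
  using sub faceD[of e g] norm_e by (auto simp: pos_cone_def)

text \<open>
  This is the condition that distinguishes strong from weak facial symmetry, applied to
  \<open>face w \<subseteq> face e\<close>. It makes \<open>S\<close> positive, since \<open>S\<close> preserves both \<open>e\<close> and the norm.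
\<close>

lemma e_S: "e (S f) = e f"
proof -
  have "e o\<^sub>L S = e"
    using sfs F_exposed S norm_e sub by (simp add: strongly_facially_symmetric_def)
  from arg_cong[OF this, of "\<lambda>U. blinfun_apply U f"] show ?thesis by simp
qed

lemma norm_S: "norm (S f) = norm f"
  using S by (simp add: symmetry_of_def)

lemma S_pos: "f \<in> C \<Longrightarrow> S f \<in> C"
  by (simp add: pos_cone_def e_S norm_S)

lemma R_pos: "f \<in> C \<Longrightarrow> R f \<in> C" and e_R: "e (R f) = e f"
  by (auto simp: R_def blinfun.add_right blinfun.scaleR_right e_S S_pos intro!: pos_cone_scale C_add)

lemma w_eq_e:
  assumes "a \<in> V" shows "w a = e a"
proof -
  have "F \<subseteq> {a. w a = e a}" using sub by (auto simp: face_def)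
  moreover have "subspace {a. w a = e a}"
    by (auto simp: subspace_def blinfun.add_right blinfun.scaleR_right)
  ultimately have "span F \<subseteq> {a. w a = e a}" by (rule span_minimal)
  moreover have "closed {a. w a = e a}"
    by (intro closed_Collect_eq continuous_intros)
  ultimately have "V \<subseteq> {a. w a = e a}" by (rule closure_minimal)
  with assms show ?thesis by blast
qed

lemma P2_in_V: "P2 f \<in> V" and P0_orth: "P0 f \<in> orth_compl F"
  using peirce_2_mem[OF S, of f] by (auto simp: P0_def R_def)

lemma P2_eqI: "a \<in> V \<Longrightarrow> b \<in> orth_compl F \<Longrightarrow> P2 (a + b) = a"
  using symmetry_fix[OF S, of a b] peirce_2_eqI[OF S, of a "a + b"]
  by (simp flip: scaleR_2)

lemma P2_linear: "linear P2" and P2_norm: "norm (P2 f) \<le> norm f"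
  and P2_neutral: "norm (P2 f) = norm f \<Longrightarrow> P2 f = f"
  using neutral_P2 by (auto simp: neutral_projection_def contractive_projection_def)

lemma zero_orth: "0 \<in> orth_compl F"
  using symmetry_subspaces(2)[OF S] by (rule subspace_0)

lemma P2_V: "a \<in> V \<Longrightarrow> P2 a = a"
  using P2_eqI[OF _ zero_orth] by simp

text \<open>
  Applying the contraction \<open>P2\<close> to a norm additive decomposition of \<open>a = P2 a\<close> cannot shorten either
  part, as the norms of the images still add up to at least \<open>norm a\<close>; by neutrality \<open>P2\<close> fixes both
  parts.
\<close>

lemma in_V_decomposition:
  assumes a: "a \<in> V"
  obtains a1 a2 where "a1 \<in> C" "a2 \<in> C" "a1 \<in> V" "a2 \<in> V" "a = a1 - a2" "norm a = norm a1 + norm a2"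
proof -
  obtain a1 a2 where d: "a1 \<in> C" "a2 \<in> C" "a = a1 - a2" "norm a = norm a1 + norm a2"
    by (rule positive_decomposition)
  have "a = P2 a1 - P2 a2" using P2_V[OF a] linear_diff[OF P2_linear] d(3) by simp
  then have "norm a \<le> norm (P2 a1) + norm (P2 a2)" using norm_triangle_ineq4 by metis
  then have "norm (P2 a1) = norm a1" "norm (P2 a2) = norm a2"
    using P2_norm[of a1] P2_norm[of a2] d(4) by auto
  then have "P2 a1 = a1" "P2 a2 = a2" using P2_neutral by auto
  then have "a1 \<in> V" "a2 \<in> V" using P2_in_V by metis+
  with d show thesis using that by blast
qed

lemma norm_add_orth:
  assumes a: "a \<in> C" "a \<in> V" and b: "b \<in> orth_compl F"
  shows "norm (b + a) = norm b + norm a"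
proof (cases "a = 0")
  case False
  have "w a = norm a" using w_eq_e[OF a(2)] a(1) by (simp add: pos_cone_def)
  then have g: "(1 / norm a) *\<^sub>R a \<in> F" using face_scaled False by blast
  show ?thesis
    using norm_add_multiple_orth[OF F_exposed b g F_norm[OF g], of "norm a"] False by simp
qed simp

text \<open>
  Split \<open>a\<close> into positive vectors, \<open>a = a1 - a2\<close>. A support functional of \<open>a2 - a1\<close> cuts out of \<open>F\<close> a smaller
  norm exposed face whose cone contains \<open>a2\<close> and to which both \<open>a1\<close> and \<open>b\<close> are orthogonal; then so is
  \<open>a1 + b\<close>. Hence the positive vector \<open>c = (a1 + b) - a2\<close> has norm \<open>norm (a1 + b) + norm a2\<close>, although
  its norm \<open>e c\<close> is at most \<open>norm (a1 + b) - norm a2\<close>. So \<open>a2 = 0\<close>, and the positivity of \<open>b\<close>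
  follows from \<open>norm (a + b) = norm a + norm b\<close>.
\<close>

lemma components_pos:
  assumes c: "a + b \<in> C" and a: "a \<in> V" and b: "b \<in> orth_compl F"
  shows "a \<in> C" "b \<in> C"
proof -
  obtain a1 a2 where d: "a1 \<in> C" "a2 \<in> C" "a1 \<in> V" "a2 \<in> V" "a = a1 - a2"
    "norm a = norm a1 + norm a2"
    using in_V_decomposition[OF a] .
  have "a2 = 0"
  proof (rule ccontr)
    assume a2: "a2 \<noteq> 0"
    obtain v :: "'a \<Rightarrow>\<^sub>L real" where v: "norm v \<le> 1" "v (a2 - a1) = norm (a2 - a1)"
      by (rule support_functional_exists)
    have va: "v a2 = norm a2" "v a1 = - norm a1"
      using v d(5,6) blinfun_abs_le[OF v(1), of a1] blinfun_abs_le[OF v(1), of a2]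
      by (auto simp: blinfun.diff_right norm_minus_commute)
    define g where "g = (1 / norm a2) *\<^sub>R a2"
    have "w a2 = norm a2" using w_eq_e[OF d(4)] d(2) by (simp add: pos_cone_def)
    then have g: "g \<in> F" "g \<in> face v" unfolding g_def using a2 va face_scaled by auto
    note mid = face_midpoint[OF norm_w v(1)]
    have G: "norm_exposed_face (F \<inter> face v)"
      using norm_exposed_faceI[OF mid(2)] g unfolding mid(1) by blast
    have "b \<in> orth_compl (F \<inter> face v)" using b by (auto simp: orth_compl_def)
    moreover have "a1 \<in> orth_compl (F \<inter> face v)"
    proof -
      have "h \<diamond> a1" if "h \<in> F" "h \<in> face v" for h
        using that orthI[OF F_pos d(1) v(1) _ va(2)] F_norm faceD(2)[OF v(1)] by simp
      then show ?thesis by (auto simp: orth_compl_def orth_sym)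
    qed
    ultimately have ab: "a1 + b \<in> orth_compl (F \<inter> face v)"
      using orth_compl_subspace[OF G] subspace_add by blast
    have "norm (a1 + b - a2) = norm (a1 + b) + norm a2"
      using norm_add_multiple_orth[OF G ab, of g "- norm a2"] g F_norm a2 by (simp add: g_def)
    moreover have "e (a1 + b - a2) = norm (a1 + b - a2)"
      using c d(5) by (simp add: pos_cone_def algebra_simps)
    moreover have "e (a1 + b - a2) = e (a1 + b) - norm a2"
      using d(2) by (simp add: blinfun.diff_right pos_cone_def)
    ultimately show False using e_abs_le[of "a1 + b"] a2 by simp
  qed
  then show aC: "a \<in> C" using d by simp
  have "norm (a + b) = norm a + norm b" using norm_add_orth[OF aC a b] by (simp add: add.commute)
  then show "b \<in> C" using c aC by (simp add: pos_cone_def blinfun.add_right)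
qed

lemma P2_pos: "f \<in> C \<Longrightarrow> P2 f \<in> C" and P0_pos: "f \<in> C \<Longrightarrow> P0 f \<in> C"
  using components_pos[of "P2 f" "P0 f"] R_pos[of f] P2_in_V[of f] P0_orth[of f]
  by (auto simp: P0_def)

lemma e_split: "e f = e (P2 f) + e (P0 f)"
  using e_R[of f] by (simp add: P0_def blinfun.diff_right)

lemma P0_linear: "linear P0"
proof -
  have "linear R"
    by (rule linearI) (simp_all add: R_def blinfun.add_right blinfun.scaleR_right algebra_simps)
  then show ?thesis
    using P2_linear unfolding P0_def by (rule linear_compose_sub)
qed

lemma R_fixed: "S f = f \<Longrightarrow> R f = f" by (simp add: R_def flip: scaleR_2)

lemma R_orth: "b \<in> orth_compl F \<Longrightarrow> P2 b = 0 \<and> P0 b = b"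
proof -
  assume b: "b \<in> orth_compl F"
  have "0 \<in> V" using symmetry_subspaces(1)[OF S] by (rule subspace_0)
  from P2_eqI[OF this b] symmetry_fix[OF S this b] R_fixed[of b]
  show ?thesis by (simp add: P0_def)
qed

text \<open>
  The functional \<open>u = e \<circ> (P2 - P0)\<close> is 1 on \<open>F\<close> and on the negatives of the positive unit vectors
  orthogonal to \<open>F\<close>. Its face therefore spans all the fixed vectors of \<open>S\<close>, and only these, up to closure,
  while its orthogonal complement is trivial. So its symmetry \<open>T\<close> has the same fixed vectors as \<open>S\<close>, which
  gives \<open>T = S\<close>, and its Peirce 2-projection is \<open>R = (I + S) / 2\<close>. For positive \<open>f\<close> the vector \<open>R f\<close> is
  positive with \<open>e (R f) = e f\<close>, that is, \<open>norm (R f) = norm f\<close>, and neutrality yields \<open>R f = f\<close>.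
\<close>

lemma S_eq_id: "S f = f"
proof -
  define \<phi> where "\<phi> f = e (P2 f) - e (P0 f)" for f
  have lin: "linear \<phi>"
    unfolding \<phi>_def
    by (rule linearI) (simp_all add: linear_add[OF P2_linear] linear_add[OF P0_linear]
        linear_scale[OF P2_linear] linear_scale[OF P0_linear] blinfun.add_right
        blinfun.scaleR_right algebra_simps)
  have pos: "\<bar>\<phi> f\<bar> \<le> e f" if "f \<in> C" for f
    using e_split[of f] P2_pos[OF that] P0_pos[OF that]
    by (simp add: \<phi>_def pos_cone_def abs_le_iff)
  have abs: "\<bar>\<phi> f\<bar> \<le> norm f" for f
  proof -
    obtain f1 f2 where f: "f1 \<in> C" "f2 \<in> C" "f = f1 - f2" "norm f = norm f1 + norm f2"
      by (rule positive_decomposition)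
    then show ?thesis
      using pos[OF f(1)] pos[OF f(2)] linear_diff[OF lin, of f1 f2] by (simp add: pos_cone_def)
  qed
  have bl: "bounded_linear \<phi>"
    using lin abs by (intro bounded_linear.intro bounded_linear_axioms.intro exI[of _ 1]) auto
  define u where "u = Blinfun \<phi>"
  have u: "blinfun_apply u = \<phi>" using bl by (simp add: u_def bounded_linear_Blinfun_apply)
  have norm_u: "norm u \<le> 1" using abs by (intro norm_blinfun_bound) (auto simp: u)
  have F_u: "F \<subseteq> face u"
  proof
    fix g assume g: "g \<in> F"
    then have gV: "g \<in> V" by (meson closure_subset span_superset subsetD)
    have "P0 g = 0" using P2_V[OF gV] symmetry_fix[OF S gV zero_orth] R_fixed[of g] by (simp add: P0_def)
    then show "g \<in> face u" using P2_V[OF gV] F_pos[OF g] F_norm[OF g]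
      by (simp add: face_def u \<phi>_def pos_cone_def)
  qed
  then have exp: "norm_exposed_face (face u)" using norm_exposed_faceI[OF norm_u] ne by blast
  then obtain T where T: "symmetry_of (face u) T" and nT: "neutral_projection (peirce_2 (face u) T)"
    by (rule symmetry_exists)
  have orth_u: "- (1 / norm b) *\<^sub>R b \<in> face u" if "b \<in> C" "b \<in> orth_compl F" "b \<noteq> 0" for b
  proof -
    have "u b = - norm b" using R_orth[OF that(2)] that(1) by (simp add: u \<phi>_def pos_cone_def linear_0[OF P2_linear])
    then show ?thesis using that(3) by (simp add: face_def blinfun.scaleR_right blinfun.minus_right)
  qed
  have F_sub_C: "F \<subseteq> C" using F_pos by blast
  have fixS: "subspace {f. S f = f}" "closed {f. S f = f}"
    by (auto simp: subspace_def blinfun.add_right blinfun.scaleR_right intro!: closed_Collect_eq continuous_intros)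
  have "face u \<subseteq> {f. S f = f}"
  proof
    fix f assume f: "f \<in> face u"
    obtain f1 f2 where d: "f1 \<in> C" "f2 \<in> C" "f = f1 - f2" "norm f = norm f1 + norm f2"
      by (rule positive_decomposition)
    have "\<phi> f1 - \<phi> f2 = e f1 + e f2"
      using faceD[OF norm_u f] d linear_diff[OF lin, of f1 f2] by (simp add: u pos_cone_def)
    then have ph: "\<phi> f1 = e f1" "\<phi> f2 = - e f2" using pos[OF d(1)] pos[OF d(2)] by auto
    \<comment> \<open>Neutrality of P2 puts f1 into the closed span of F, whereas u itself witnesses that f2 is
    orthogonal to F.\<close>
    have "e (P0 f1) = 0" using ph(1) e_split[of f1] by (simp add: \<phi>_def)
    then have "e (P2 f1) = e f1" using e_split[of f1] by simp
    then have "norm (P2 f1) = norm f1" using P2_pos[OF d(1)] d(1) by (simp add: pos_cone_def)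
    then have "f1 \<in> V" using P2_neutral P2_in_V by metis
    then have 1: "S f1 = f1" using symmetry_fix[OF S _ zero_orth] by fastforce
    have "g \<diamond> f2" if g: "g \<in> F" for g
      using orthI[OF F_pos[OF g] d(2) norm_u] g F_u faceD[OF norm_u, of g] ph(2) d(2)
      by (auto simp: u pos_cone_def)
    then have "f2 \<in> orth_compl F" by (auto simp: orth_compl_def orth_sym)
    then have "S f2 = f2" using symmetry_fix[OF S, of 0 f2] subspace_0[OF symmetry_subspaces(1)[OF S]] by simp
    with 1 show "f \<in> {f. S f = f}" by (simp add: d(3) blinfun.diff_right)
  qed
  then have sub1: "closure (span (face u)) \<subseteq> {f. S f = f}"
    by (rule closure_minimal[OF span_minimal[OF _ fixS(1)] fixS(2)])
  have V_sub: "V \<subseteq> closure (span (face u))"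
    using F_u by (intro closure_mono span_mono)
  note subu = symmetry_subspaces(1)[OF T]
  have orth_sub: "b \<in> closure (span (face u))" if orth: "b \<in> orth_compl F" for b
  proof -
    have pos: "b \<in> closure (span (face u))" if b: "b \<in> C" "b \<in> orth_compl F" for b
    proof (cases "b = 0")
      case True
      then show ?thesis using subspace_0[OF subu] by simp
    next
      case False
      have "- (1 / norm b) *\<^sub>R b \<in> closure (span (face u))"
        using orth_u[OF b False] by (meson closure_subset span_superset subsetD)
      from subspace_scale[OF subu this, of "- norm b"] show ?thesis using False by simp
    qed
    obtain b1 b2 where "b1 \<in> C" "b2 \<in> C" "b1 \<in> orth_compl F" "b2 \<in> orth_compl F" "b = b1 - b2"
      "norm b = norm b1 + norm b2"
      by (rule orth_compl_decomposition[OF F_sub_C orth])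
    then show ?thesis using pos subspace_diff[OF subu] by blast
  qed
  have span_u: "closure (span (face u)) = {f. S f = f}"
  proof
    show "{f. S f = f} \<subseteq> closure (span (face u))"
    proof
      fix f assume "f \<in> {f. S f = f}"
      then obtain a b where "f = a + b" "a \<in> V" "b \<in> orth_compl F"
        using symmetry_fixE[OF S] by blast
      then show "f \<in> closure (span (face u))" using V_sub orth_sub subspace_add[OF subu] by blast
    qed
  qed (rule sub1)
  have orth_0: "k = 0" if k: "k \<in> orth_compl (face u)" for k
  proof -
    have "k \<in> orth_compl F" using k F_u by (auto simp: orth_compl_def)
    then obtain k1 k2 where d: "k1 \<in> C" "k2 \<in> C" "k1 \<in> orth_compl F" "k2 \<in> orth_compl F" "k = k1 - k2"
      "norm k = norm k1 + norm k2"
      by (rule orth_compl_decomposition[OF F_sub_C])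
    \<comment> \<open>k is orthogonal to its own positive and negative parts, which are multiples of elements of the face.\<close>
    have *: "norm (k - t *\<^sub>R b) = norm k + \<bar>t\<bar> * norm b" if b: "b \<in> C" "b \<in> orth_compl F" for b t
    proof (cases "b = 0")
      case False
      show ?thesis
        using norm_add_multiple_orth[OF exp k orth_u[OF b False], of "t * norm b"] False
        by (simp add: abs_mult)
    qed simp
    have "norm k2 = norm k + norm k1" "norm k1 = norm k + norm k2"
      using *[OF d(1,3), of 1] *[OF d(2,4), of "-1"] by (simp_all add: d(5))
    then have "norm k = 0" by linarith
    then show "k = 0" by simp
  qed
  have fixT: "{f. T f = f} = closure (span (face u))"
  proof
    show "{f. T f = f} \<subseteq> closure (span (face u))"
    proof
      fix f assume "f \<in> {f. T f = f}"
      then obtain a b where "f = a + b" "a \<in> closure (span (face u))" "b \<in> orth_compl (face u)"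
        using symmetry_fixE[OF T] by blast
      then have "f = a" using orth_0[of b] by simp
      with \<open>a \<in> closure (span (face u))\<close> show "f \<in> closure (span (face u))" by simp
    qed
  next
    show "closure (span (face u)) \<subseteq> {f. T f = f}"
    proof
      fix f assume "f \<in> closure (span (face u))"
      then show "f \<in> {f. T f = f}"
        using symmetry_fix[OF T _ subspace_0[OF symmetry_subspaces(2)[OF T]]] by fastforce
    qed
  qed
  have ST: "S = T"
  proof (rule symmetry_unique)
    show "{f. S f = f} = {f. T f = f}" unfolding fixT by (rule span_u[symmetric])
  qed (use S T in \<open>simp_all add: symmetry_of_def\<close>)
  have R_eq: "peirce_2 (face u) T f = R f" for f
  proof (rule peirce_2_eqI[OF T])
    have "S (R f) = R f"
      by (simp add: R_def blinfun.add_right blinfun.scaleR_right symmetry_involution[OF S] add.commute)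
    then show "R f \<in> closure (span (face u))" unfolding span_u by simp
    show "(1/2) *\<^sub>R (f + T f) - R f \<in> orth_compl (face u)"
      using subspace_0[OF symmetry_subspaces(2)[OF T]] by (simp add: R_def flip: ST)
  qed
  have pos_fix: "S f = f" if f: "f \<in> C" for f
  proof -
    have "norm (R f) = norm f" using R_pos[OF f] f e_R[of f] by (simp add: pos_cone_def)
    then have "R f = f" using nT R_eq by (simp add: neutral_projection_def)
    then have "2 *\<^sub>R R f = f + f" by (simp add: scaleR_2)
    then show ?thesis by (simp add: R_def)
  qed
  obtain f1 f2 where "f1 \<in> C" "f2 \<in> C" "f = f1 - f2"
    by (rule positive_decomposition)
  then show "S f = f" using pos_fix by (simp add: blinfun.diff_right)
qed

lemma band_projection_P2: "band_projection e P2"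
proof -
  have "P0 f = f - P2 f" for f using R_fixed[OF S_eq_id, of f] by (simp add: P0_def)
  then show ?thesis
    using P2_linear P2_V[OF P2_in_V] P2_pos P0_pos by (simp add: band_projection_def)
qed

end

context unitary_sfs
begin

text \<open>
  A support functional \<open>u\<close> of \<open>f = f1 - f2\<close> attains \<open>norm f1\<close> at \<open>f1\<close> and \<open>- norm f2\<close> at \<open>f2\<close>. Hence \<open>f1\<close> lies in
  the cone of the face of \<open>(e + u) / 2\<close>, which is \<open>face e \<inter> face u\<close>, and \<open>f2\<close> is orthogonal to this face; so its
  Peirce 2-projection takes \<open>f\<close> to \<open>f1\<close>. If \<open>f1 = 0\<close>, the face can be empty, but then \<open>P = 0\<close> will do.
\<close>

theorem split_by_band_projection:
  obtains P where "band_projection e P" "P f \<in> C" "P f - f \<in> C" "norm f = norm (P f) + norm (P f - f)"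
proof -
  obtain f1 f2 where d: "f1 \<in> C" "f2 \<in> C" "f = f1 - f2" "norm f = norm f1 + norm f2"
    by (rule positive_decomposition)
  show thesis
  proof (cases "f1 = 0")
    case True
    have "band_projection e (\<lambda>_. 0)" by (auto simp: band_projection_def intro!: linearI)
    then show ?thesis
    proof (rule that)
      have eq: "0 - f = f2" using True d(3) by simp
      show "0 - f \<in> C" unfolding eq by (rule d(2))
      show "norm f = norm (0::'a) + norm (0 - f)" unfolding eq using d(4) True by simp
    qed simp
  next
    case False
    obtain u :: "'a \<Rightarrow>\<^sub>L real" where u: "norm u \<le> 1" "u f = norm f" by (rule support_functional_exists)
    have uf: "u f1 = norm f1" "u f2 = - norm f2"
      using u d(3,4) blinfun_abs_le[OF u(1), of f1] blinfun_abs_le[OF u(1), of f2]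
      by (auto simp: blinfun.diff_right)
    define w where "w = (1/2) *\<^sub>R (e + u)"
    have w: "face w = face e \<inter> face u" "norm w \<le> 1"
      unfolding w_def using face_midpoint[of e u] norm_e u(1) by auto
    have "e f1 = norm f1" using d(1) by (simp add: pos_cone_def)
    then have g: "(1 / norm f1) *\<^sub>R f1 \<in> face w"
      using face_scaled[OF False uf(1)] face_scaled[OF False] w by simp
    then obtain S where S: "symmetry_of (face w) S" "neutral_projection (peirce_2 (face w) S)"
      using norm_exposed_faceI[OF w(2)] symmetry_exists by blast
    interpret positive_face e w S
      using w g S by unfold_locales auto
    have "g \<diamond> f2" if "g \<in> face w" for g
      using orthI[OF F_pos[OF that] d(2) u(1) _ uf(2)] that w F_norm[OF that] faceD(2)[OF u(1)] by auto
    then have "- f2 \<in> orth_compl (face w)"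
      using subspace_neg[OF orth_compl_subspace[OF F_exposed]] by (auto simp: orth_compl_def orth_sym)
    moreover have "(1 / norm f1) *\<^sub>R f1 \<in> V" using g by (meson closure_subset span_superset subsetD)
    then have "f1 \<in> V"
      using subspace_scale[OF symmetry_subspaces(1)[OF S(1)], of _ "norm f1"] False by force
    ultimately have P2f: "P2 f = f1" using P2_eqI[of f1 "- f2"] d(3) by simp
    have eq: "f1 - f = f2" using d(3) by simp
    show ?thesis
    proof (rule that[OF band_projection_P2])
      show "P2 f \<in> C" unfolding P2f by (rule d(1))
      show "P2 f - f \<in> C" unfolding P2f eq by (rule d(2))
      show "norm f = norm (P2 f) + norm (P2 f - f)" unfolding P2f eq by (rule d(4))
    qed
  qed
qed

end

section \<open>Band projections and components\<close>

lemma subspace_closure: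
  fixes S :: "'a::real_normed_vector set"
  assumes S: "subspace S" shows "subspace (closure S)"
proof (rule subspaceI)
  show "0 \<in> closure S" using subspace_0[OF S] closure_subset by blast
  fix x y assume "x \<in> closure S" "y \<in> closure S"
  then obtain f g where "\<forall>n. f n \<in> S" "f \<longlonglongrightarrow> x" "\<forall>n. g n \<in> S" "g \<longlonglongrightarrow> y"
    by (auto simp: closure_sequential)
  then show "x + y \<in> closure S"
    unfolding closure_sequential
    by (intro exI[of _ "\<lambda>n. f n + g n"]) (auto intro: tendsto_add subspace_add[OF S])
next
  fix c :: real and x assume "x \<in> closure S"
  then obtain f where "\<forall>n. f n \<in> S" "f \<longlonglongrightarrow> x" by (auto simp: closure_sequential)
  then show "c *\<^sub>R x \<in> closure S"
    unfolding closure_sequential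
    by (intro exI[of _ "\<lambda>n. c *\<^sub>R f n"]) (auto intro: tendsto_scaleR subspace_scale[OF S])
qed

text \<open>
  An abstract L-space, presented by its norm-additive cone and its band projections. The first two
  conclusions about \<open>P\<close> say that \<open>P f\<close> is the positive part of \<open>f\<close>.
\<close>

locale al_space =
  fixes e :: "'a::banach \<Rightarrow>\<^sub>L real"
  assumes norm_e_le: "norm e \<le> 1"
    and split_exists: "\<exists>P. band_projection e P \<and> P f \<in> pos_cone e \<and> P f - f \<in> pos_cone e \<and>
      norm f = norm (P f) + norm (P f - f)"
begin

abbreviation C where "C \<equiv> pos_cone e"
abbreviation band where "band \<equiv> band_projection e"

lemmas C_add = pos_cone_add[OF norm_e_le]

lemma C_antisym:
  assumes "f \<in> C" "- f \<in> C" shows "f = 0"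
proof -
  have "- norm f = norm f" using assms by (simp add: pos_cone_def blinfun.minus_right)
  then show ?thesis by simp
qed

lemma C_norm_mono:
  assumes "f \<in> C" "g - f \<in> C" shows "norm f \<le> norm g"
  using C_add(2)[OF assms] by simp

lemma split:
  obtains P where "band P" "P f \<in> C" "P f - f \<in> C" "norm f = norm (P f) + norm (P f - f)"
  using split_exists[of f] by blast

lemma band_linear: "band P \<Longrightarrow> linear P"
  and band_idem: "band P \<Longrightarrow> P (P f) = P f"
  and band_pos: "band P \<Longrightarrow> f \<in> C \<Longrightarrow> P f \<in> C"
  and band_compl_pos: "band P \<Longrightarrow> f \<in> C \<Longrightarrow> f - P f \<in> C"
  by (auto simp: band_projection_def)

lemma band_diff: "band P \<Longrightarrow> P (f - g) = P f - P g"
  and band_add: "band P \<Longrightarrow> P (f + g) = P f + P g"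
  and band_scale: "band P \<Longrightarrow> P (c *\<^sub>R f) = c *\<^sub>R P f"
  and band_zero_arg: "band P \<Longrightarrow> P 0 = 0"
  and band_sum: "band P \<Longrightarrow> P (sum h I) = (\<Sum>i\<in>I. P (h i))"
  using band_linear linear_diff linear_add linear_scale linear_0 linear_sum by blast+

lemma eq_on_C:
  assumes "linear P" "linear Q" "\<And>f. f \<in> C \<Longrightarrow> P f = Q f" shows "P f = Q f"
proof -
  obtain T where T: "T f \<in> C" "T f - f \<in> C" by (rule split[of f])
  have "P (T f - (T f - f)) = Q (T f - (T f - f))"
    using assms(3)[OF T(1)] assms(3)[OF T(2)] linear_diff[OF assms(1), of "T f" "T f - f"]
      linear_diff[OF assms(2), of "T f" "T f - f"] by simp
  then show ?thesis by simp
qed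

lemma band_id: "band (\<lambda>f. f)" and band_zero: "band (\<lambda>f. 0)"
  by (auto simp: band_projection_def intro!: linearI)

lemma band_compl:
  assumes "band P" shows "band (\<lambda>f. f - P f)"
  using assms linear_compose_sub[OF linear_ident band_linear[OF assms]]
  by (auto simp: band_projection_def band_diff[OF assms])

text \<open>
  For positive \<open>f\<close> the vector \<open>Q (P f)\<close> lies between 0 and \<open>P f\<close>, so the positive projection \<open>I - P\<close> annihilates
  it. The same for \<open>I - P\<close> in place of \<open>P\<close> gives the other half of \<open>P Q = P Q P = Q P\<close>.
\<close>

lemma band_commute:
  assumes P: "band P" and Q: "band Q" shows "P (Q f) = Q (P f)"
proof -
  have stay: "P (Q (P f)) = Q (P f)" if P: "band P" and Q: "band Q" and f: "f \<in> C" for P Q f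
  proof -
    have "Q (P f) - P (Q (P f)) \<in> C" using P Q f by (auto intro: band_pos band_compl_pos)
    moreover have "(P f - Q (P f)) - P (P f - Q (P f)) \<in> C"
      using P Q f by (auto intro: band_pos band_compl_pos)
    ultimately show ?thesis
      using C_antisym[of "Q (P f) - P (Q (P f))"] by (simp add: band_diff[OF P] band_idem[OF P])
  qed
  have "P (Q f) = Q (P f)" if f: "f \<in> C" for f
  proof -
    have "P (Q (f - P f)) = 0"
      using stay[OF band_compl[OF P] Q f] by simp
    then show ?thesis using stay[OF P Q f] by (simp add: band_diff[OF P] band_diff[OF Q])
  qed
  moreover have "linear (\<lambda>f. P (Q f))" "linear (\<lambda>f. Q (P f))"
    using linear_compose[OF band_linear[OF P] band_linear[OF Q]] 
      linear_compose[OF band_linear[OF Q] band_linear[OF P]] by (auto simp: o_def)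
  ultimately show ?thesis using eq_on_C by blast
qed

lemma band_comp:
  assumes P: "band P" and Q: "band Q" shows "band (\<lambda>f. P (Q f))"
proof -
  have "linear (\<lambda>f. P (Q f))"
    using linear_compose[OF band_linear[OF Q] band_linear[OF P]] by (auto simp: o_def)
  moreover have "P (Q (P (Q f))) = P (Q f)" for f
    using band_commute[OF P Q] band_idem[OF P] band_idem[OF Q] by metis
  moreover have "f - P (Q f) \<in> C" if "f \<in> C" for f
    using C_add(1)[OF band_compl_pos[OF Q that] band_compl_pos[OF P band_pos[OF Q that]]] by simp
  ultimately show ?thesis using band_pos[OF P] band_pos[OF Q] by (auto simp: band_projection_def)
qed

lemma norm_band_split:
  assumes P: "band P" shows "norm f = norm (P f) + norm (f - P f)"
proof -
  obtain T where T: "T f \<in> C" "T f - f \<in> C" "norm f = norm (T f) + norm (T f - f)" by (rule split[of f])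
  define a b where "a = T f" and "b = T f - f"
  have ab: "a \<in> C" "b \<in> C" "norm f = norm a + norm b" "f = a - b" using T by (auto simp: a_def b_def)
  have s: "norm g = norm (P g) + norm (g - P g)" if "g \<in> C" for g
    using C_add(2)[OF band_pos[OF P that] band_compl_pos[OF P that]] by simp
  have "norm (P f) \<le> norm (P a) + norm (P b)" 
    using norm_triangle_ineq4[of "P a" "P b"] ab(4) band_diff[OF P] by simp
  moreover have "norm (f - P f) \<le> norm (a - P a) + norm (b - P b)"
  proof -
    have "f - P f = (a - P a) - (b - P b)" unfolding ab(4) band_diff[OF P] by simp
    then show ?thesis using norm_triangle_ineq4[of "a - P a" "b - P b"] by simp
  qed
  moreover have "norm f \<le> norm (P f) + norm (f - P f)"
    using norm_triangle_ineq[of "P f" "f - P f"] by simp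
  ultimately show ?thesis using s[OF ab(1)] s[OF ab(2)] ab(3) by linarith
qed

lemma closed_C: "closed C"
  unfolding pos_cone_def by (intro closed_Collect_eq continuous_intros)

text \<open>
  For positive \<open>x\<close> these are the components (or fragments) of \<open>x\<close>: the vectors \<open>a\<close> that are disjoint from
  \<open>x - a\<close>.
\<close>

definition components :: "'a \<Rightarrow> 'a set" where "components x = {P x | P. band P}"

text \<open>
  A dyadic form of Freudenthal's spectral theorem. If \<open>P\<close> projects onto the band where \<open>f \<ge> x / 2\<close>, then
  \<open>h = 2 f - P x\<close> again lies between 0 and \<open>x\<close>; as \<open>f = (P x + h) / 2\<close>, iteration expands \<open>f\<close> into a series
  of components with coefficients \<open>1/2, 1/4, 1/8, ...\<close>.
\<close>

lemma order_interval_in_closed_span_components: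
  assumes "f \<in> C" "x - f \<in> C"
  shows "f \<in> closure (span (components x))"
proof -
  have approx: "\<exists>s \<in> span (components x). norm (f - s) \<le> norm x / 2 ^ n"
    if "f \<in> C" "x - f \<in> C" for f n
    using that
  proof (induction n arbitrary: f)
    case 0
    then show ?case using C_norm_mono[OF 0] by (intro bexI[of _ 0]) (auto simp: span_zero)
  next
    case (Suc n)
    define g where "g = 2 *\<^sub>R f - x"
    obtain P where P: "band P" "P g \<in> C" "P g - g \<in> C" by (rule split[of g])
    define h where "h = 2 *\<^sub>R f - P x"
    have "P g + 2 *\<^sub>R (f - P f) \<in> C"
      using P band_compl_pos[OF P(1) Suc.prems(1)] by (intro C_add(1) pos_cone_scale) auto
    then have 1: "h \<in> C"
      by (simp add: h_def g_def band_diff[OF P(1)] band_scale[OF P(1)] scaleR_diff_right)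
    have "2 *\<^sub>R P (x - f) + (P g - g) \<in> C"
      using P band_pos[OF P(1) Suc.prems(2)] by (intro C_add(1) pos_cone_scale) auto
    then have 2: "x - h \<in> C"
      by (simp add: h_def g_def band_diff[OF P(1)] band_scale[OF P(1)] scaleR_diff_right)
         (simp add: algebra_simps scaleR_2)
    obtain s where s: "s \<in> span (components x)" "norm (h - s) \<le> norm x / 2 ^ n"
      using Suc.IH[OF 1 2] by blast
    have "P x \<in> span (components x)" using P(1) by (intro span_base) (auto simp: components_def)
    then have "(1/2) *\<^sub>R (P x + s) \<in> span (components x)" using s(1) by (intro span_scale span_add)
    moreover have "f - (1/2) *\<^sub>R (P x + s) = (1/2) *\<^sub>R (h - s)"
      by (simp add: h_def algebra_simps)
    then have "norm (f - (1/2) *\<^sub>R (P x + s)) \<le> norm x / 2 ^ Suc n" using s(2) by simp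
    ultimately show ?case by blast
  qed
  show ?thesis
    unfolding closure_approachable
  proof (intro allI impI)
    fix \<epsilon> :: real assume "\<epsilon> > 0"
    have "(\<lambda>n. norm x * (1 / 2) ^ n) \<longlonglongrightarrow> 0"
      by (intro tendsto_mult_right_zero LIMSEQ_power_zero) auto
    then have "eventually (\<lambda>n. norm x * (1 / 2) ^ n < \<epsilon>) sequentially"
      using \<open>\<epsilon> > 0\<close> by (rule order_tendstoD(2))
    then obtain n where "norm x / 2 ^ n < \<epsilon>" by (auto simp: eventually_sequentially power_one_over field_simps)
    then show "\<exists>s\<in>span (components x). dist s f < \<epsilon>"
      using approx[OF assms, of n] by (force simp: dist_norm norm_minus_commute)
  qed
qed

definition separated :: "'a \<Rightarrow> 'a \<Rightarrow> bool" where
  "separated x y \<longleftrightarrow> (\<exists>P. band P \<and> P x = x \<and> P y = 0)"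

lemma separated_sym: "separated x y \<Longrightarrow> separated y x"
proof -
  assume "separated x y"
  then obtain P where P: "band P" "P x = x" "P y = 0" unfolding separated_def by blast
  then show ?thesis
    unfolding separated_def by (intro exI[of _ "\<lambda>f. f - P f"]) (simp add: band_compl)
qed

definition disjoint_units :: "'a set \<Rightarrow> bool" where
  "disjoint_units J \<longleftrightarrow> (\<forall>x\<in>J. x \<in> C \<and> norm x = 1) \<and> pairwise separated J"

lemma maximal_disjoint_units_exist:
  obtains J where "disjoint_units J" "\<forall>r\<in>C. (\<forall>x\<in>J. separated x r) \<longrightarrow> r = 0"
proof -
  have "\<exists>J\<in>Collect disjoint_units. \<forall>X\<in>Collect disjoint_units. J \<subseteq> X \<longrightarrow> X = J"
  proof (rule subset_Zorn')
    fix \<C> assume ch: "subset.chain (Collect disjoint_units) \<C>"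
    have "pairwise separated (\<Union>\<C>)"
    proof (rule pairwiseI)
      fix x y assume "x \<in> \<Union>\<C>" "y \<in> \<Union>\<C>" "x \<noteq> y"
      then obtain X Y where "X \<in> \<C>" "Y \<in> \<C>" "x \<in> X" "y \<in> Y" by blast
      then obtain Z where "Z \<in> \<C>" "x \<in> Z" "y \<in> Z" 
        using ch unfolding subset.chain_def by blast
      then show "separated x y"
        using ch \<open>x \<noteq> y\<close> by (auto simp: subset.chain_def disjoint_units_def pairwise_def)
    qed
    then show "\<Union>\<C> \<in> Collect disjoint_units"
      using ch by (auto simp: subset.chain_def disjoint_units_def)
  qed
  then obtain J where J: "disjoint_units J" and max: "\<And>X. disjoint_units X \<Longrightarrow> J \<subseteq> X \<Longrightarrow> X = J"
    by auto
  show thesis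
  proof (rule that[OF J], intro ballI impI)
    fix r assume r: "r \<in> C" "\<forall>x\<in>J. separated x r"
    show "r = 0"
    proof (rule ccontr)
      assume r0: "r \<noteq> 0"
      define r' where "r' = (1 / norm r) *\<^sub>R r"
      have r': "r' \<in> C" "norm r' = 1" using r(1) r0 by (auto simp: r'_def intro: pos_cone_scale)
      have sep: "separated x r'" if x: "x \<in> J" for x
      proof -
        obtain P where P: "band P" "P x = x" "P r = 0" using r(2) x unfolding separated_def by blast
        then show ?thesis by (auto simp: separated_def r'_def band_scale)
      qed
      have "disjoint_units (insert r' J)"
        using J r' sep separated_sym by (auto simp: disjoint_units_def pairwise_insert)
      then have "r' \<in> J" using max[of "insert r' J"] by blast
      with sep obtain P where "P r' = r'" "P r' = 0" unfolding separated_def by blast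
      then show False using r'(2) by simp
    qed
  qed
qed

text \<open>
  Subtract from \<open>f\<close>, again and again, a vector of \<open>H\<close> between 0 and the current remainder, whose norm is at
  least half the supremum of what is possible. The norms of these vectors sum up to at most \<open>norm f\<close>, so the
  remainders converge. A vector of \<open>H\<close> between 0 and their limit would have been available at each step, so
  its norm is at most twice a null sequence.
\<close>

lemma exhaustion:
  assumes H: "subspace H" "closed H" and f: "f \<in> C"
  obtains r where "r \<in> C" "f - r \<in> H" "\<And>d. d \<in> H \<Longrightarrow> d \<in> C \<Longrightarrow> r - d \<in> C \<Longrightarrow> d = 0"
proof -
  define D where "D r = {d \<in> H. d \<in> C \<and> r - d \<in> C}" for r
  have bdd: "bdd_above (norm ` D r)" for r
    using C_norm_mono by (intro bdd_aboveI[of _ "norm r"]) (auto simp: D_def)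
  have "\<exists>d. d \<in> D r \<and> (\<forall>d'\<in>D r. norm d' \<le> 2 * norm d)" if "r \<in> C" for r
  proof -
    have 0: "0 \<in> D r" using that subspace_0[OF H(1)] by (simp add: D_def)
    define s where "s = (SUP d\<in>D r. norm d)"
    have le: "norm d \<le> s" if "d \<in> D r" for d unfolding s_def using bdd that by (intro cSUP_upper2) auto
    show ?thesis
    proof (cases "s = 0")
      case True
      then show ?thesis using 0 le by force
    next
      case False
      then have "s / 2 < s" using le[OF 0] by simp
      then obtain d where "d \<in> D r" "s / 2 < norm d"
        using less_cSUP_iff[OF _ bdd, of r "s / 2"] 0 unfolding s_def[symmetric] by blast
      then show ?thesis using le by (intro exI[of _ d]) force
    qed
  qed
  then obtain d where d: "\<And>r. r \<in> C \<Longrightarrow> d r \<in> D r" "\<And>r d'. r \<in> C \<Longrightarrow> d' \<in> D r \<Longrightarrow> norm d' \<le> 2 * norm (d r)"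
    by metis
  define \<rho> where "\<rho> n = ((\<lambda>r. r - d r) ^^ n) f" for n
  have rec: "\<rho> (Suc n) = \<rho> n - d (\<rho> n)" for n by (simp add: \<rho>_def)
  have \<rho>C: "\<rho> n \<in> C" for n
  proof (induction n)
    case 0 then show ?case using f by (simp add: \<rho>_def)
  next
    case (Suc n) then show ?case using d(1)[OF Suc] by (simp add: \<rho>_def D_def)
  qed
  have dn: "d (\<rho> n) \<in> H" "d (\<rho> n) \<in> C" "\<rho> n - d (\<rho> n) \<in> C" for n
    using d(1)[OF \<rho>C] by (auto simp: D_def)
  have step: "norm (\<rho> n) = norm (\<rho> (Suc n)) + norm (d (\<rho> n))" for n
    using C_add(2)[OF dn(3) dn(2), of n n] by (simp add: rec)
  have "(\<Sum>k<n. norm (d (\<rho> k))) = norm (\<rho> 0) - norm (\<rho> n)" for n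
  proof (induction n)
    case (Suc n)
    then show ?case using step[of n] by simp
  qed simp
  then have bound: "(\<Sum>k<n. norm (d (\<rho> k))) \<le> norm (\<rho> 0)" for n by simp
  have summ: "summable (\<lambda>k. norm (d (\<rho> k)))"
    using bound by (intro summableI_nonneg_bounded[where x = "norm (\<rho> 0)"]) auto
  have sum_eq: "f - \<rho> n = (\<Sum>k<n. d (\<rho> k))" for n
  proof (induction n)
    case 0
    show ?case by (simp add: \<rho>_def)
  next
    case (Suc n)
    have "f - \<rho> (Suc n) = (f - \<rho> n) + d (\<rho> n)" by (simp add: rec)
    then show ?case by (simp add: Suc.IH)
  qed
  obtain t where t: "(\<lambda>n. f - \<rho> n) \<longlonglongrightarrow> t"
    using summable_LIMSEQ[OF summable_norm_cancel[OF summ]] sum_eq by auto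
  define r where "r = f - t"
  have lim: "\<rho> \<longlonglongrightarrow> r" using tendsto_diff[OF tendsto_const[of f] t] by (simp add: r_def)
  have "r \<in> C" using closed_C \<rho>C lim by (rule closed_sequentially)
  moreover have "f - r \<in> H"
  proof -
    have "f - \<rho> n \<in> H" for n unfolding sum_eq using H(1) dn(1) by (intro subspace_sum) auto
    then show ?thesis using closed_sequentially[OF H(2) _ t] by (simp add: r_def)
  qed
  moreover have "d' = 0" if d': "d' \<in> H" "d' \<in> C" "r - d' \<in> C" for d'
  proof -
    have mono: "\<rho> n - \<rho> (n + m) \<in> C" for n m
    proof (induction m)
      case (Suc m)
      have "\<rho> n - \<rho> (n + Suc m) = (\<rho> n - \<rho> (n + m)) + d (\<rho> (n + m))" by (simp add: rec)
      then show ?case using C_add(1)[OF Suc dn(2)] by (simp only:)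
    qed simp
    have "\<rho> n - r \<in> C" for n
    proof (rule closed_sequentially[OF closed_C])
      show "(\<lambda>m. \<rho> n - \<rho> (n + m)) \<longlonglongrightarrow> \<rho> n - r"
        using LIMSEQ_ignore_initial_segment[OF lim, of n] by (intro tendsto_intros) (simp add: add.commute)
    qed (rule mono)
    then have "\<rho> n - d' \<in> C" for n using C_add(1)[OF _ d'(3), of "\<rho> n - r"] by simp
    then have "norm d' \<le> 2 * norm (d (\<rho> n))" for n
      using d' d(2)[OF \<rho>C] by (simp add: D_def)
    moreover have "(\<lambda>n. 2 * norm (d (\<rho> n))) \<longlonglongrightarrow> 0"
      using summable_LIMSEQ_zero[OF summ] by (intro tendsto_mult_right_zero)
    ultimately have "norm d' \<le> 0" using LIMSEQ_le_const by blast
    then show ?thesis by simp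
  qed
  ultimately show thesis using that by blast
qed

text \<open>
  The part of a positive vector that is left after exhausting it by the closed span is disjoint from each
  \<open>x \<in> J\<close>, because order intervals \<open>[0, x]\<close> are contained in the closed span. By maximality it is zero.
\<close>

lemma components_dense:
  assumes J: "disjoint_units J"
    and max: "\<forall>r\<in>C. (\<forall>x\<in>J. separated x r) \<longrightarrow> r = 0"
  shows "closure (span (\<Union>x\<in>J. components x)) = UNIV"
proof -
  define H where "H = closure (span (\<Union>x\<in>J. components x))"
  have H: "subspace H" "closed H" unfolding H_def by (auto intro: subspace_closure)
  have int: "f \<in> H" if "x \<in> J" "f \<in> C" "x - f \<in> C" for f x
  proof -
    have "closure (span (components x)) \<subseteq> H"
      unfolding H_def using that by (intro closure_mono span_mono) auto
    then show ?thesis using order_interval_in_closed_span_components[OF that(2,3)] by blast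
  qed
  have pos: "f \<in> H" if f: "f \<in> C" for f
  proof -
    obtain r where r: "r \<in> C" "f - r \<in> H" "\<And>d. d \<in> H \<Longrightarrow> d \<in> C \<Longrightarrow> r - d \<in> C \<Longrightarrow> d = 0"
      using exhaustion[OF H f] by blast
    have "separated x r" if x: "x \<in> J" for x
    proof -
      have xC: "x \<in> C" using J x by (auto simp: disjoint_units_def)
      obtain P where P: "band P" "P (x - r) \<in> C" "P (x - r) - (x - r) \<in> C" by (rule split)
      have r1: "P r \<in> C" and r2: "r - P r \<in> C" and x1: "P x \<in> C" and x2: "x - P x \<in> C"
        using P(1) r(1) xC band_pos band_compl_pos by auto
      have b1: "x - P r \<in> C" using C_add(1)[OF P(2) x2] by (simp add: band_diff[OF P(1)])
      have b2: "r - (x - P x) \<in> C"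
        using C_add(1)[OF P(3) r1] by (simp add: band_diff[OF P(1)] algebra_simps)
      have "x - P x = 0" using r(3)[OF int[OF x x2] x2 b2] x1 by simp
      moreover have "P r = 0" using r(3)[OF int[OF x r1 b1] r1 r2] .
      ultimately show ?thesis using P(1) by (auto simp: separated_def)
    qed
    then have "r = 0" using max r(1) by blast
    then show ?thesis using r(2) by simp
  qed
  have "f \<in> H" for f
  proof -
    obtain P where "P f \<in> C" "P f - f \<in> C" by (rule split[of f])
    then have "P f - (P f - f) \<in> H" using pos subspace_diff[OF H(1)] by blast
    then show ?thesis by simp
  qed
  then show ?thesis by (auto simp: H_def)
qed

text \<open>
  The product of the projections that separate \<open>x\<close> from the individual elements of \<open>I\<close> does it.
\<close>

lemma finite_separation:
  assumes J: "disjoint_units J" and I: "finite I" "I \<subseteq> J" and x: "x \<in> J" "x \<notin> I"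
  obtains R where "band R" "R x = x" "\<And>y. y \<in> I \<Longrightarrow> R y = 0"
proof -
  have "\<exists>R. band R \<and> R x = x \<and> (\<forall>y\<in>I. R y = 0)" using I x(2)
  proof (induction I)
    case empty
    then show ?case using band_id by blast
  next
    case (insert y I)
    then obtain R where R: "band R" "R x = x" "\<forall>y\<in>I. R y = 0" by auto
    have "separated x y"
      using J x(1) insert.prems by (auto simp: disjoint_units_def pairwise_def)
    then obtain P where P: "band P" "P x = x" "P y = 0" unfolding separated_def by blast
    have "R (P y') = 0" if "y' \<in> I" for y'
      using R(3) that band_commute[OF R(1) P(1), of y'] band_zero_arg[OF P(1)] by simp
    then show ?case
      using R(1,2) P band_comp[OF R(1) P(1)] band_zero_arg[OF R(1)]
      by (intro exI[of _ "\<lambda>f. R (P f)"]) auto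
  qed
  then show thesis using that by blast
qed

end

section \<open>Disjoint sums of measures\<close>

definition sum_measure :: "'i set \<Rightarrow> ('i \<Rightarrow> 'b measure) \<Rightarrow> ('i \<times> 'b) measure" where
  "sum_measure J N = measure_of (SIGMA x:J. space (N x))
     {A. A \<subseteq> (SIGMA x:J. space (N x)) \<and> (\<forall>x\<in>J. Pair x -` A \<in> sets (N x))}
     (\<lambda>A. \<integral>\<^sup>+x. emeasure (N x) (Pair x -` A) \<partial>count_space J)"

lemma sigma_algebra_sum_measure:
  "sigma_algebra (SIGMA x:J. space (N x))
     {A. A \<subseteq> (SIGMA x:J. space (N x)) \<and> (\<forall>x\<in>J. Pair x -` A \<in> sets (N x))}"
  unfolding sigma_algebra_iff2
proof (intro conjI ballI allI impI)
  let ?S = "{A. A \<subseteq> (SIGMA x:J. space (N x)) \<and> (\<forall>x\<in>J. Pair x -` A \<in> sets (N x))}"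
  fix A assume A: "A \<in> ?S"
  have "Pair x -` ((SIGMA x:J. space (N x)) - A) = space (N x) - Pair x -` A" if "x \<in> J" for x
    using that by auto
  then show "(SIGMA x:J. space (N x)) - A \<in> ?S" using A by auto
next
  let ?S = "{A. A \<subseteq> (SIGMA x:J. space (N x)) \<and> (\<forall>x\<in>J. Pair x -` A \<in> sets (N x))}"
  fix A :: "nat \<Rightarrow> _" assume "range A \<subseteq> ?S"
  then show "(\<Union>i. A i) \<in> ?S" by (auto simp: vimage_UN)
qed auto

lemma sets_sum_measure:
  "sets (sum_measure J N) =
     {A. A \<subseteq> (SIGMA x:J. space (N x)) \<and> (\<forall>x\<in>J. Pair x -` A \<in> sets (N x))}"
  unfolding sum_measure_def
  by (subst sets_measure_of) (auto simp: sigma_algebra.sigma_sets_eq[OF sigma_algebra_sum_measure])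

lemma emeasure_sum_measure:
  assumes "A \<in> sets (sum_measure J N)"
  shows "emeasure (sum_measure J N) A = (\<integral>\<^sup>+x. emeasure (N x) (Pair x -` A) \<partial>count_space J)"
proof (rule emeasure_measure_of[OF sum_measure_def _ _ _ assms])
  show "positive (sets (sum_measure J N)) (\<lambda>A. \<integral>\<^sup>+x. emeasure (N x) (Pair x -` A) \<partial>count_space J)"
    by (simp add: positive_def)
  show "countably_additive (sets (sum_measure J N)) (\<lambda>A. \<integral>\<^sup>+x. emeasure (N x) (Pair x -` A) \<partial>count_space J)"
  proof (rule countably_additiveI)
    fix A :: "nat \<Rightarrow> _" assume A: "range A \<subseteq> sets (sum_measure J N)" "disjoint_family A"
    have "(\<Sum>i. \<integral>\<^sup>+x. emeasure (N x) (Pair x -` A i) \<partial>count_space J) =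
        (\<integral>\<^sup>+x. (\<Sum>i. emeasure (N x) (Pair x -` A i)) \<partial>count_space J)"
      by (rule nn_integral_suminf[symmetric]) simp
    also have "\<dots> = (\<integral>\<^sup>+x. emeasure (N x) (Pair x -` (\<Union>i. A i)) \<partial>count_space J)"
    proof (rule nn_integral_cong)
      fix x assume "x \<in> space (count_space J)"
      then have "range (\<lambda>i. Pair x -` A i) \<subseteq> sets (N x)" using A(1) by (auto simp: sets_sum_measure)
      moreover have "disjoint_family (\<lambda>i. Pair x -` A i)" using A(2) by (auto simp: disjoint_family_on_def)
      ultimately show "(\<Sum>i. emeasure (N x) (Pair x -` A i)) = emeasure (N x) (Pair x -` (\<Union>i. A i))"
        by (simp add: suminf_emeasure vimage_UN)
    qed
    finally show "(\<Sum>i. \<integral>\<^sup>+x. emeasure (N x) (Pair x -` A i) \<partial>count_space J) =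
      (\<integral>\<^sup>+x. emeasure (N x) (Pair x -` (\<Union>i. A i)) \<partial>count_space J)" .
  qed
qed auto

section \<open>The Stone space of the components of a vector\<close>

context al_space
begin

text \<open>
  The meet of the components \<open>P x\<close> and \<open>Q x\<close> is \<open>P (Q x)\<close>; as band projections commute, it depends only
  on the two components.
\<close>

definition meet_closed :: "'a \<Rightarrow> 'a set \<Rightarrow> bool" where
  "meet_closed x U \<longleftrightarrow> U \<subseteq> components x \<and> x \<in> U \<and> 0 \<notin> U \<and>
     (\<forall>P Q. band P \<longrightarrow> band Q \<longrightarrow> P x \<in> U \<longrightarrow> Q x \<in> U \<longrightarrow> P (Q x) \<in> U)"

text \<open>
  Maximal meet-closed sets without 0. Being decided on each complementary pair of components makes them
  upward closed, hence the ultrafilters of the Boolean algebra.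
\<close>

definition ultra :: "'a \<Rightarrow> 'a set set" where
  "ultra x = {U. meet_closed x U \<and> (\<forall>P. band P \<longrightarrow> P x \<in> U \<or> x - P x \<in> U)}"

definition clopen :: "'a \<Rightarrow> ('a \<Rightarrow> 'a) \<Rightarrow> 'a set set" where
  "clopen x P = {U \<in> ultra x. P x \<in> U}"

lemma meet_closedD:
  assumes "meet_closed x U"
  shows "x \<in> U" "0 \<notin> U" "U \<subseteq> components x"
    "band P \<Longrightarrow> band Q \<Longrightarrow> P x \<in> U \<Longrightarrow> Q x \<in> U \<Longrightarrow> P (Q x) \<in> U"
  using assms unfolding meet_closed_def by blast+

text \<open>
  A maximal meet-closed extension \<open>U\<close> is an ultrafilter: adjoining the meets of \<open>P x \<notin> U\<close> with the elements of
  \<open>U\<close> must produce 0, so \<open>U\<close> has an element disjoint from \<open>P x\<close>. If this happened for \<open>P x\<close> and for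
  \<open>x - P x\<close>, the meet of the two witnesses would be 0.
\<close>

lemma ultra_extension:
  assumes V: "meet_closed x V"
  obtains U where "U \<in> ultra x" "V \<subseteq> U"
proof -
  define \<V> where "\<V> = {U. V \<subseteq> U \<and> meet_closed x U}"
  have "\<exists>U\<in>\<V>. \<forall>W\<in>\<V>. U \<subseteq> W \<longrightarrow> W = U"
  proof (rule subset_Zorn_nonempty)
    show "\<V> \<noteq> {}" using V by (auto simp: \<V>_def)
    fix \<C> assume \<C>: "\<C> \<noteq> {}" "subset.chain \<V> \<C>"
    have \<C>V: "U \<in> \<C> \<Longrightarrow> V \<subseteq> U \<and> meet_closed x U" for U
      using \<C>(2) unfolding subset.chain_def \<V>_def by blast
    have "meet_closed x (\<Union>\<C>)"
      unfolding meet_closed_def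
    proof (intro conjI allI impI)
      fix P Q assume PQ: "band P" "band Q" "P x \<in> \<Union>\<C>" "Q x \<in> \<Union>\<C>"
      then obtain X Y where "X \<in> \<C>" "Y \<in> \<C>" "P x \<in> X" "Q x \<in> Y" by blast
      then obtain Z where "Z \<in> \<C>" "P x \<in> Z" "Q x \<in> Z"
        using \<C>(2) unfolding subset.chain_def by blast
      then show "P (Q x) \<in> \<Union>\<C>" using \<C>V meet_closedD(4) PQ(1,2) by blast
    qed (use \<C>(1) \<C>V meet_closedD in blast)+
    then show "\<Union>\<C> \<in> \<V>" using \<C>(1) \<C>V by (auto simp: \<V>_def)
  qed
  then obtain U where U\<V>: "U \<in> \<V>" and max\<V>: "\<And>W. W \<in> \<V> \<Longrightarrow> U \<subseteq> W \<Longrightarrow> W = U" by blast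
  from U\<V> have VU: "V \<subseteq> U" and U: "meet_closed x U" by (auto simp: \<V>_def)
  have max: "W = U" if "meet_closed x W" "U \<subseteq> W" for W
    using max\<V>[of W] that VU by (auto simp: \<V>_def)
  have opposite_element: "\<exists>Q. band Q \<and> Q x \<in> U \<and> P (Q x) = 0" if P: "band P" "P x \<notin> U" for P
  proof (rule ccontr)
    assume no: "\<not> ?thesis"
    define W where "W = U \<union> {P (Q x) | Q. band Q \<and> Q x \<in> U}"
    have "meet_closed x W"
      unfolding meet_closed_def
    proof (intro conjI allI impI)
      show "W \<subseteq> components x"
        using meet_closedD(3)[OF U] band_comp[OF P(1)] by (auto simp: W_def components_def)
      show "x \<in> W" using meet_closedD(1)[OF U] by (simp add: W_def)
      show "0 \<notin> W" using no meet_closedD(2)[OF U] by (auto simp: W_def)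
      fix A B assume A: "band A" "A x \<in> W" and B: "band B" "B x \<in> W"
      have mem: "P (Q x) \<in> W" if "band Q" "Q x \<in> U" for Q using that by (auto simp: W_def)
      note comm = band_commute
      from A(2) consider (1) "A x \<in> U" | (2) A' where "band A'" "A' x \<in> U" "A x = P (A' x)"
        by (auto simp: W_def)
      then show "A (B x) \<in> W"
      proof cases
        case 1
        from B(2) consider (3) "B x \<in> U" | (4) B' where "band B'" "B' x \<in> U" "B x = P (B' x)"
          by (auto simp: W_def)
        then show ?thesis
        proof cases
          case 3
          then show ?thesis using 1 A(1) B(1) meet_closedD(4)[OF U] by (simp add: W_def)
        next
          case 4
          have "A (B x) = P (A (B' x))" using 4 comm[OF A(1) P(1)] by simp
          moreover have "A (B' x) \<in> U" using 4 1 A(1) meet_closedD(4)[OF U] by blast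
          ultimately show ?thesis using mem[OF band_comp[OF A(1) 4(1)]] by simp
        qed
      next
        case 2
        from B(2) consider (3) "B x \<in> U" | (4) B' where "band B'" "B' x \<in> U" "B x = P (B' x)"
          by (auto simp: W_def)
        then show ?thesis
        proof cases
          case 3
          have "A (B x) = P (B (A' x))" using 2 comm[OF A(1) B(1)] comm[OF B(1) P(1)] by simp
          moreover have "B (A' x) \<in> U" using 2 3 B(1) meet_closedD(4)[OF U] by blast
          ultimately show ?thesis using mem[OF band_comp[OF B(1) 2(1)]] by simp
        next
          case 4
          have "A (B x) = P (B' (A x))" using 4 comm[OF A(1) P(1)] comm[OF A(1) 4(1)] by simp
          also have "\<dots> = P (P (B' (A' x)))" using 2 comm[OF 4(1) P(1)] by simp
          finally have "A (B x) = P (B' (A' x))" using band_idem[OF P(1)] by simp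
          moreover have "B' (A' x) \<in> U" using 2 4 meet_closedD(4)[OF U] by blast
          ultimately show ?thesis using mem[OF band_comp[OF 4(1) 2(1)]] by simp
        qed
      qed
    qed
    moreover have "P x \<in> W" using meet_closedD(1)[OF U] band_id by (force simp: W_def)
    ultimately show False using max[of W] P(2) by (auto simp: W_def)
  qed
  have "P x \<in> U \<or> x - P x \<in> U" if P: "band P" for P
  proof (rule ccontr)
    assume n: "\<not> ?thesis"
    obtain Q where Q: "band Q" "Q x \<in> U" "P (Q x) = 0" using opposite_element[OF P] n by blast
    obtain Q' where Q': "band Q'" "Q' x \<in> U" "Q' x - P (Q' x) = 0"
      using opposite_element[OF band_compl[OF P]] n by blast
    have "Q (Q' x) = Q (P (Q' x))" using Q'(3) by simp
    also have "\<dots> = Q' (P (Q x))"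
      using band_commute[OF P Q'(1)] band_commute[OF Q(1) Q'(1)] band_commute[OF Q(1) P] by simp
    also have "\<dots> = 0" using Q(3) band_zero_arg[OF Q'(1)] by simp
    finally show False using meet_closedD(2,4)[OF U] Q(1,2) Q'(1,2) by metis
  qed
  then show thesis using U VU that by (auto simp: ultra_def)
qed

lemma ultra_compl_iff:
  assumes U: "U \<in> ultra x" and P: "band P"
  shows "x - P x \<in> U \<longleftrightarrow> P x \<notin> U"
proof -
  have "\<not> (P x \<in> U \<and> x - P x \<in> U)"
  proof
    assume "P x \<in> U \<and> x - P x \<in> U"
    then have "P (x - P x) \<in> U" using U P band_compl[OF P] meet_closedD(4) by (auto simp: ultra_def)
    then show False using U meet_closedD(2) by (auto simp: ultra_def band_diff[OF P] band_idem[OF P])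
  qed
  then show ?thesis using U P by (auto simp: ultra_def)
qed

lemma ultra_meet_iff:
  assumes U: "U \<in> ultra x" and P: "band P" and Q: "band Q"
  shows "P (Q x) \<in> U \<longleftrightarrow> P x \<in> U \<and> Q x \<in> U"
proof -
  have mc: "meet_closed x U" using U by (simp add: ultra_def)
  have "A x \<in> U" if A: "band A" and B: "band B" and AB: "A (B x) \<in> U" for A B
  proof (rule ccontr)
    assume "A x \<notin> U"
    then have "x - A x \<in> U" using ultra_compl_iff[OF U A] by simp
    then have "A (B x) - A (A (B x)) \<in> U"
      using meet_closedD(4)[OF mc band_compl[OF A] band_comp[OF A B]] AB by simp
    then show False using band_idem[OF A] meet_closedD(2)[OF mc] by simp
  qed
  from this[OF P Q] this[OF Q P] band_commute[OF P Q, of x] meet_closedD(4)[OF mc P Q]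
  show ?thesis by auto
qed

lemma clopen_compl: "band P \<Longrightarrow> ultra x - clopen x P = clopen x (\<lambda>f. f - P f)"
  using ultra_compl_iff by (auto simp: clopen_def)

lemma clopen_inter: "band P \<Longrightarrow> band Q \<Longrightarrow> clopen x P \<inter> clopen x Q = clopen x (\<lambda>f. P (Q f))"
  using ultra_meet_iff by (auto simp: clopen_def)

lemma clopen_empty_iff:
  assumes "band P" shows "clopen x P = {} \<longleftrightarrow> P x = 0"
proof
  assume e: "clopen x P = {}"
  show "P x = 0"
  proof (rule ccontr)
    assume nz: "P x \<noteq> 0"
    have "meet_closed x {x, P x}"
      unfolding meet_closed_def
    proof (intro conjI allI impI)
      show "{x, P x} \<subseteq> components x" using assms band_id by (force simp: components_def)
      show "0 \<notin> {x, P x}" using nz band_zero_arg[OF assms] by auto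
      fix A B assume A: "band A" "A x \<in> {x, P x}" and B: "band B" "B x \<in> {x, P x}"
      have "A (P x) = P (A x)" by (rule band_commute[OF A(1) assms])
      then show "A (B x) \<in> {x, P x}" using A(2) B(2) band_idem[OF assms] by auto
    qed simp
    then obtain U where "U \<in> ultra x" "{x, P x} \<subseteq> U" by (rule ultra_extension)
    with e show False by (auto simp: clopen_def)
  qed
next
  assume "P x = 0"
  then show "clopen x P = {}" using meet_closedD(2) by (auto simp: clopen_def ultra_def)
qed

lemma clopen_eqD:
  assumes "band P" "band Q" "clopen x P = clopen x Q" shows "P x = Q x"
proof -
  have sub: "A x = B (A x)" if A: "band A" and B: "band B" and eq: "clopen x A = clopen x B" for A B
  proof -
    have "clopen x (\<lambda>f. A f - B (A f)) = {}"
      using clopen_inter[OF band_compl[OF B] A, of x] clopen_compl[OF B, of x] eq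
      by (auto simp: clopen_def)
    then show ?thesis using clopen_empty_iff[OF band_comp[OF band_compl[OF B] A], of x] by simp
  qed
  from sub[OF assms] sub[OF assms(2,1) assms(3)[symmetric]] band_commute[OF assms(1,2), of x]
  show ?thesis by simp
qed

definition clopens :: "'a \<Rightarrow> 'a set set set" where "clopens x = {clopen x P | P. band P}"

lemma algebra_clopens: "algebra (ultra x) (clopens x)"
  unfolding algebra_iff_Int
proof (intro conjI ballI)
  show "clopens x \<subseteq> Pow (ultra x)" by (auto simp: clopens_def clopen_def)
  have "clopen x (\<lambda>_. 0) = {}" using clopen_empty_iff[OF band_zero] by simp
  then show "{} \<in> clopens x" using band_zero unfolding clopens_def by blast
  show "ultra x - a \<in> clopens x" if "a \<in> clopens x" for a
    using that clopen_compl band_compl unfolding clopens_def by blast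
  show "a \<inter> b \<in> clopens x" if "a \<in> clopens x" "b \<in> clopens x" for a b
    using that clopen_inter band_comp unfolding clopens_def by blast
qed

text \<open>
  The content \<open>norm (P x)\<close> of clopen sets is additive because the norm is additive on the cone. It is continuous
  at the empty set for a trivial reason: a decreasing sequence of non-empty clopen sets has a common point, by
  \<open>ultra_extension\<close>.
\<close>

lemma stone_measure_exists:
  assumes x: "x \<in> C"
  shows "\<exists>N. space N = ultra x \<and> sets N = sigma_sets (ultra x) (clopens x) \<and>
    (\<forall>P. band P \<longrightarrow> emeasure N (clopen x P) = ennreal (norm (P x)))"
proof -
  interpret algebra "ultra x" "clopens x" by (rule algebra_clopens)
  define m where "m A = ennreal (norm ((SOME P. band P \<and> A = clopen x P) x))" for A
  have m: "m (clopen x P) = ennreal (norm (P x))" if P: "band P" for P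
  proof -
    have "band (SOME Q. band Q \<and> clopen x P = clopen x Q) \<and>
      clopen x P = clopen x (SOME Q. band Q \<and> clopen x P = clopen x Q)"
      using P by (intro someI[of "\<lambda>Q. band Q \<and> clopen x P = clopen x Q" P]) simp
    then have "(SOME Q. band Q \<and> clopen x P = clopen x Q) x = P x"
      using clopen_eqD P by metis
    then show ?thesis by (simp add: m_def)
  qed
  have "\<exists>\<mu>. (\<forall>s\<in>clopens x. \<mu> s = m s) \<and> measure_space (ultra x) (sigma_sets (ultra x) (clopens x)) \<mu>"
  proof (rule caratheodory_empty_continuous)
    have "clopen x (\<lambda>_. 0) = {}" using clopen_empty_iff[OF band_zero] by simp
    then show "positive (clopens x) m" using m[OF band_zero] by (simp add: positive_def)
    show "additive (clopens x) m"
      unfolding additive_def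
    proof (intro ballI impI)
      fix a b assume "a \<in> clopens x" "b \<in> clopens x" and dis: "a \<inter> b = {}"
      then obtain P Q where P: "band P" "a = clopen x P" and Q: "band Q" "b = clopen x Q"
        by (auto simp: clopens_def)
      have 0: "P (Q x) = 0"
        using dis clopen_inter[OF P(1) Q(1), of x] clopen_empty_iff[OF band_comp[OF P(1) Q(1)], of x]
        by (simp add: P Q)
      define S where "S f = f - (\<lambda>g. g - P g) (f - Q f)" for f
      have S: "band S"
        unfolding S_def using band_compl[OF band_comp[OF band_compl[OF P(1)] band_compl[OF Q(1)]]] by simp
      have Sx: "S x = P x + Q x" by (simp add: S_def band_diff[OF P(1)] 0)
      have "a \<union> b = ultra x - ((ultra x - a) \<inter> (ultra x - b))" by (auto simp: P Q clopen_def)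
      also have "\<dots> = clopen x S"
        unfolding S_def P(2) Q(2)
        using clopen_compl[OF P(1), of x] clopen_compl[OF Q(1), of x]
          clopen_inter[OF band_compl[OF P(1)] band_compl[OF Q(1)], of x]
          clopen_compl[OF band_comp[OF band_compl[OF P(1)] band_compl[OF Q(1)]], of x]
        by simp
      finally have "m (a \<union> b) = ennreal (norm (P x + Q x))" using m[OF S] Sx by simp
      then show "m (a \<union> b) = m a + m b"
        using m[OF P(1)] m[OF Q(1)] C_add(2)[OF band_pos[OF P(1) x] band_pos[OF Q(1) x]]
        by (simp add: P(2) Q(2))
    qed
    show "m A \<noteq> \<infinity>" for A by (simp add: m_def)
    fix A assume A: "range A \<subseteq> clopens x" "decseq A" "(\<Inter>i. A i) = {}"
    have "\<exists>P. band P \<and> A i = clopen x P" for i using A(1) by (auto simp: clopens_def)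
    then obtain P where P: "\<And>i. band (P i)" "\<And>i. A i = clopen x (P i)" by metis
    have meet: "P i (P j x) = P (max i j) x" for i j
    proof -
      have "A i \<inter> A j = A (max i j)" using decseqD[OF A(2), of i j] decseqD[OF A(2), of j i]
        by (cases i j rule: le_cases) (auto simp: max_absorb1 max_absorb2)
      then have "clopen x (\<lambda>f. P i (P j f)) = clopen x (P (max i j))"
        using clopen_inter[OF P(1) P(1), of x] by (simp add: P(2))
      from clopen_eqD[OF band_comp[OF P(1) P(1)] P(1) this] show ?thesis .
    qed
    have "\<exists>n. P n x = 0"
    proof (rule ccontr)
      assume nz: "\<nexists>n. P n x = 0"
      have "meet_closed x (insert x (range (\<lambda>n. P n x)))"
        unfolding meet_closed_def
      proof (intro conjI allI impI)
        show "insert x (range (\<lambda>n. P n x)) \<subseteq> components x"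
          using P(1) band_id by (force simp: components_def)
        show "0 \<notin> insert x (range (\<lambda>n. P n x))" using nz band_zero_arg[OF P(1)] by (metis image_iff insert_iff)
        fix D E assume D: "band D" "D x \<in> insert x (range (\<lambda>n. P n x))"
          and E: "band E" "E x \<in> insert x (range (\<lambda>n. P n x))"
        have "D (P n x) = P n (D x)" for n by (rule band_commute[OF D(1) P(1)])
        then show "D (E x) \<in> insert x (range (\<lambda>n. P n x))" using D(2) E(2) meet by auto
      qed simp
      then obtain U where "U \<in> ultra x" "insert x (range (\<lambda>n. P n x)) \<subseteq> U" by (rule ultra_extension)
      then have "U \<in> (\<Inter>i. A i)" by (auto simp: P(2) clopen_def)
      with A(3) show False by blast
    qed
    then obtain n where "A n = {}" using clopen_empty_iff P by metis
    then have "A k = clopen x (\<lambda>_. 0)" if "k \<ge> n" for k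
      using A(2) that clopen_empty_iff[OF band_zero, of x] unfolding decseq_def by fastforce
    then have "m (A k) = 0" if "k \<ge> n" for k using that m[OF band_zero] by simp
    then show "(\<lambda>i. m (A i)) \<longlonglongrightarrow> 0"
      by (intro tendsto_eventually) (auto simp: eventually_sequentially)
  qed
  then obtain \<mu> where \<mu>: "\<forall>s\<in>clopens x. \<mu> s = m s"
    and ms: "measure_space (ultra x) (sigma_sets (ultra x) (clopens x)) \<mu>" by blast
  have cl: "clopens x \<subseteq> Pow (ultra x)" using space_closed .
  define N where "N = measure_of (ultra x) (clopens x) \<mu>"
  have sN: "sets N = sigma_sets (ultra x) (clopens x)" unfolding N_def using cl by (rule sets_measure_of)
  have "emeasure N (clopen x P) = ennreal (norm (P x))" if P: "band P" for P
  proof -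
    have c: "clopen x P \<in> clopens x" using P by (auto simp: clopens_def)
    have "emeasure N (clopen x P) = \<mu> (clopen x P)"
    proof (rule emeasure_measure_of[OF N_def cl])
      show "positive (sets N) \<mu>" "countably_additive (sets N) \<mu>"
        using ms by (auto simp: sN measure_space_def)
      show "clopen x P \<in> sets N" using c by (auto simp: sN)
    qed
    then show ?thesis using \<mu> c m[OF P] by simp
  qed
  moreover have "space N = ultra x" unfolding N_def using cl by (rule space_measure_of)
  ultimately show ?thesis using sN by blast
qed

end

section \<open>Completeness of L1 along fast Cauchy sequences\<close>

lemma L1_limit_of_fast_Cauchy:
  fixes h :: "nat \<Rightarrow> 'b \<Rightarrow> real"
  assumes int [measurable]: "\<And>n. integrable M (h n)"
    and fast: "\<And>n. (\<integral>z. \<bar>h (Suc n) z - h n z\<bar> \<partial>M) \<le> (1/2) ^ n"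
  obtains g where "integrable M g" "(\<lambda>n. \<integral>z. \<bar>h n z - g z\<bar> \<partial>M) \<longlonglongrightarrow> 0"
proof -
  define d where "d n z = h (Suc n) z - h n z" for n z
  have intd: "integrable M (d n)" for n unfolding d_def using int by (intro Bochner_Integration.integrable_diff)
  have summ: "summable (\<lambda>n. \<integral>z. \<bar>d n z\<bar> \<partial>M)"
  proof (rule summable_comparison_test'[where g = "\<lambda>n. (1/2::real) ^ n" and N = 0])
    show "summable (\<lambda>n. (1/2::real) ^ n)" by (rule summable_geometric) simp
    show "norm (\<integral>z. \<bar>d n z\<bar> \<partial>M) \<le> (1/2) ^ n" for n
      using fast[of n] unfolding d_def by (subst real_norm_def, subst abs_of_nonneg) (auto intro: integral_nonneg_AE)
  qed
  have AE: "AE z in M. summable (\<lambda>n. \<bar>d n z\<bar>)"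
  proof -
    have [measurable]: "d n \<in> borel_measurable M" for n using intd by simp
    have eq: "(\<integral>\<^sup>+z. ennreal \<bar>d n z\<bar> \<partial>M) = ennreal (\<integral>z. \<bar>d n z\<bar> \<partial>M)" for n
      by (rule nn_integral_eq_integral[OF integrable_abs[OF intd]]) simp
    have "(\<integral>\<^sup>+z. (\<Sum>n. ennreal \<bar>d n z\<bar>) \<partial>M) = (\<Sum>n. \<integral>\<^sup>+z. ennreal \<bar>d n z\<bar> \<partial>M)"
      by (rule nn_integral_suminf) simp
    also have "\<dots> = (\<Sum>n. ennreal (\<integral>z. \<bar>d n z\<bar> \<partial>M))"
      by (simp only: eq)
    also have "\<dots> \<noteq> \<infinity>"
      unfolding infinity_ennreal_def by (rule ennreal_suminf_neq_top[OF summ integral_nonneg_AE]) simp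
    finally have "AE z in M. (\<Sum>n. ennreal \<bar>d n z\<bar>) \<noteq> \<infinity>"
      by (intro nn_integral_noteq_infinite) auto
    then show ?thesis by eventually_elim (auto intro: summable_suminf_not_top)
  qed
  define g where "g z = h 0 z + (\<Sum>n. d n z)" for z
  define W where "W z = (\<Sum>n. \<bar>d n z\<bar>)" for z
  have AE': "AE z in M. summable (\<lambda>n. norm (d n z))" using AE by simp
  have intS: "integrable M (\<lambda>z. \<Sum>n. d n z)"
    using intd AE' summ by (intro integrable_suminf) auto
  have intW: "integrable M W"
    unfolding W_def using intd AE summ by (intro integrable_suminf) auto
  have intg: "integrable M g" unfolding g_def using int intS by (intro Bochner_Integration.integrable_add)
  have tel: "h n z - g z = - (\<Sum>k. d (k + n) z)" if "summable (\<lambda>n. \<bar>d n z\<bar>)" for n z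
  proof -
    have s: "summable (\<lambda>n. d n z)" by (rule summable_rabs_cancel[OF that])
    have "h n z = h 0 z + (\<Sum>k<n. d k z)" by (induction n) (auto simp: d_def)
    moreover have "g z = h 0 z + ((\<Sum>k. d (k + n) z) + (\<Sum>k<n. d k z))"
      unfolding g_def suminf_split_initial_segment[OF s, of n] ..
    ultimately show ?thesis by linarith
  qed
  have "(\<lambda>n. \<integral>z. \<bar>h n z - g z\<bar> \<partial>M) \<longlonglongrightarrow> (\<integral>z. 0 \<partial>M)"
  proof (rule integral_dominated_convergence[where w = W])
    show "AE z in M. (\<lambda>n. \<bar>h n z - g z\<bar>) \<longlonglongrightarrow> 0"
      using AE
    proof eventually_elim
      case (elim z)
      have "summable (\<lambda>n. d n z)" by (rule summable_rabs_cancel[OF elim])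
      from suminf_exist_split2[OF this] have "(\<lambda>n. \<bar>\<Sum>k. d (k + n) z\<bar>) \<longlonglongrightarrow> 0"
        by (rule tendsto_rabs_zero)
      then show ?case by (simp add: tel[OF elim])
    qed
    show "AE z in M. norm \<bar>h n z - g z\<bar> \<le> W z" for n
      using AE
    proof eventually_elim
      case (elim z)
      have sn: "summable (\<lambda>k. \<bar>d (k + n) z\<bar>)" using elim by (rule summable_ignore_initial_segment)
      have "\<bar>\<Sum>k. d (k + n) z\<bar> \<le> (\<Sum>k. \<bar>d (k + n) z\<bar>)" using sn by (rule summable_rabs)
      also have "\<dots> \<le> (\<Sum>k. \<bar>d (k + n) z\<bar>) + (\<Sum>k<n. \<bar>d k z\<bar>)" by (simp add: sum_nonneg)
      also have "\<dots> = W z" unfolding W_def using suminf_split_initial_segment[OF elim, of n] by simp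
      finally show ?case by (simp add: tel[OF elim])
    qed
    show "(\<lambda>z. \<bar>h n z - g z\<bar>) \<in> borel_measurable M" for n using int intg by measurable
  qed (use intW in auto)
  then show thesis using that intg by simp
qed

section \<open>Step functions\<close>

text \<open>
  The hypotheses on \<open>J\<close> hold for every maximal family of disjoint units, by \<open>components_dense\<close>.
\<close>

locale al_space_units = al_space e for e :: "'a::banach \<Rightarrow>\<^sub>L real" +
  fixes J :: "'a set"
  assumes J: "disjoint_units J" and dense: "closure (span (\<Union>x\<in>J. components x)) = UNIV"
begin

lemma J_pos: "x \<in> J \<Longrightarrow> x \<in> C" and J_norm: "x \<in> J \<Longrightarrow> norm x = 1"
  using J by (auto simp: disjoint_units_def)

definition stone_measure :: "'a \<Rightarrow> 'a set measure" where
  "stone_measure x = (SOME N. space N = ultra x \<and> sets N = sigma_sets (ultra x) (clopens x) \<and>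
    (\<forall>P. band P \<longrightarrow> emeasure N (clopen x P) = ennreal (norm (P x))))"

definition M :: "('a \<times> 'a set) measure" where "M = sum_measure J stone_measure"

lemma stone_measure_props:
  assumes "x \<in> J"
  shows space_stone_measure: "space (stone_measure x) = ultra x" and sets_stone_measure: "sets (stone_measure x) = sigma_sets (ultra x) (clopens x)"
    and emeasure_stone_measure_clopen: "band P \<Longrightarrow> emeasure (stone_measure x) (clopen x P) = ennreal (norm (P x))"
  using someI_ex[OF stone_measure_exists[OF J_pos[OF assms]]] unfolding stone_measure_def[symmetric] by auto

text \<open>
  The part of the measure space that \<open>P\<close> cuts out of the Stone spaces with index in \<open>I\<close>. For finite \<open>I\<close> its
  measure is the norm of \<open>P\<close> applied to the sum of \<open>I\<close>.
\<close>

definition region :: "'a set \<Rightarrow> ('a \<Rightarrow> 'a) \<Rightarrow> ('a \<times> 'a set) set" where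
  "region I P = (SIGMA x:I. clopen x P)"

lemma clopen_in_sets: "x \<in> J \<Longrightarrow> band P \<Longrightarrow> clopen x P \<in> sets (stone_measure x)"
  using sets_stone_measure by (auto simp: clopens_def)

lemma Sigma_in_sets:
  assumes "I \<subseteq> J" "\<And>x. x \<in> I \<Longrightarrow> B x \<in> sets (stone_measure x)"
  shows "Sigma I B \<in> sets M"
proof -
  have "Sigma I B \<subseteq> (SIGMA x:J. space (stone_measure x))"
    using assms sets.sets_into_space by fastforce
  moreover have "Pair x -` Sigma I B = (if x \<in> I then B x else {})" for x by auto
  ultimately show ?thesis using assms(2) by (auto simp: M_def sets_sum_measure)
qed

lemma region_in_sets [measurable]: "I \<subseteq> J \<Longrightarrow> band P \<Longrightarrow> region I P \<in> sets M"
  unfolding region_def using clopen_in_sets by (intro Sigma_in_sets) auto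

lemma norm_sum_C:
  assumes "finite I" "\<And>i. i \<in> I \<Longrightarrow> h i \<in> C"
  shows "sum h I \<in> C \<and> norm (sum h I) = (\<Sum>i\<in>I. norm (h i))"
  using assms by (induction I) (auto simp: C_add)

lemma emeasure_region:
  assumes I: "finite I" "I \<subseteq> J" and P: "band P"
  shows "emeasure M (region I P) = ennreal (norm (P (\<Sum>I)))"
proof -
  have "emeasure M (region I P) = (\<integral>\<^sup>+x. emeasure (stone_measure x) (Pair x -` region I P) \<partial>count_space J)"
    unfolding M_def using region_in_sets[OF I(2) P] by (intro emeasure_sum_measure) (simp add: M_def)
  also have "\<dots> = (\<Sum>x\<in>I. emeasure (stone_measure x) (Pair x -` region I P))"
  proof (rule nn_integral_count_space'[OF I(1) _ I(2)])
    fix x assume "x \<notin> I"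
    then have "Pair x -` region I P = {}" by (auto simp: region_def)
    then show "emeasure (stone_measure x) (Pair x -` region I P) = 0" by simp
  qed
  also have "\<dots> = (\<Sum>x\<in>I. ennreal (norm (P x)))"
  proof (rule sum.cong)
    fix x assume "x \<in> I"
    then have "Pair x -` region I P = clopen x P" by (auto simp: region_def)
    then show "emeasure (stone_measure x) (Pair x -` region I P) = ennreal (norm (P x))"
      using emeasure_stone_measure_clopen[of x P] P \<open>x \<in> I\<close> I by auto
  qed simp
  also have "\<dots> = ennreal (\<Sum>x\<in>I. norm (P x))" by (intro sum_ennreal) simp
  also have "(\<Sum>x\<in>I. norm (P x)) = norm (P (\<Sum>I))"
  proof -
    have "P x \<in> C" if "x \<in> I" for x using that I(2) J_pos band_pos[OF P] by blast
    then show ?thesis using norm_sum_C[OF I(1), of P] band_sum[OF P, of "\<lambda>x. x" I] by simp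
  qed
  finally show ?thesis .
qed

lemma integrable_region:
  assumes "finite I" "I \<subseteq> J" "band P" shows "integrable M (indicator (region I P) :: _ \<Rightarrow> real)"
  using emeasure_region[OF assms] region_in_sets[OF assms(2,3)] by (intro integrable_real_indicator) auto

text \<open>
  A list of triples \<open>(c, P, x)\<close> stands both for the vector \<open>\<Sum> c P x\<close> and for the step function with the
  same coefficients on the clopen sets of the components \<open>P x\<close>. Working with lists avoids having to show
  that the step function depends only on the vector before the norms are compared.
\<close>

definition step_data :: "(real \<times> ('a \<Rightarrow> 'a) \<times> 'a) list \<Rightarrow> bool" where
  "step_data xs \<longleftrightarrow> (\<forall>(c, P, x)\<in>set xs. band P \<and> x \<in> J)"

fun step_vector :: "(real \<times> ('a \<Rightarrow> 'a) \<times> 'a) list \<Rightarrow> 'a" where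
  "step_vector [] = 0" | "step_vector ((c, P, x) # xs) = c *\<^sub>R P x + step_vector xs"

fun step_function :: "(real \<times> ('a \<Rightarrow> 'a) \<times> 'a) list \<Rightarrow> 'a \<times> 'a set \<Rightarrow> real" where
  "step_function [] z = 0" | "step_function ((c, P, x) # xs) z = c * indicator (region {x} P) z + step_function xs z"

lemma step_vector_append: "step_vector (xs @ ys) = step_vector xs + step_vector ys"
  by (induction xs) auto

lemma step_function_append: "step_function (xs @ ys) z = step_function xs z + step_function ys z"
  by (induction xs) auto

definition scaled where "scaled a xs = map (\<lambda>(c, P, x). (a * c, P, x)) xs"

lemma step_vector_scaled: "step_vector (scaled a xs) = a *\<^sub>R step_vector xs"
  by (induction xs) (auto simp: scaled_def scaleR_add_right)

lemma step_function_scaled: "step_function (scaled a xs) z = a * step_function xs z"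
  by (induction xs) (auto simp: scaled_def algebra_simps)

lemma step_data_simps [simp]: "step_data []" "step_data ((c, P, x) # xs) \<longleftrightarrow> band P \<and> x \<in> J \<and> step_data xs"
  "step_data (xs @ ys) \<longleftrightarrow> step_data xs \<and> step_data ys"
  by (simp_all add: step_data_def ball_Un)

lemma step_data_scaled [simp]: "step_data xs \<Longrightarrow> step_data (scaled a xs)"
  by (auto simp: step_data_def scaled_def)

lemma integrable_step: "step_data xs \<Longrightarrow> integrable M (step_function xs)"
proof (induction xs)
  case Nil
  then show ?case by simp
next
  case (Cons a xs)
  obtain c P x where a: "a = (c, P, x)" by (cases a)
  have "integrable M (\<lambda>z. c * indicator (region {x} P) z + step_function xs z)"
    using Cons a by (intro Bochner_Integration.integrable_add integrable_mult_right integrable_region) auto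
  then show ?case by (simp add: a)
qed

text \<open>
  Only \<open>x\<close> survives under a projection \<open>R\<close> that separates \<open>x\<close> from the rest of \<open>I\<close>, so \<open>K = P R\<close> cuts exactly the
  clopen set of \<open>P x\<close> out of the region of \<open>I\<close>.
\<close>

lemma region_split:
  assumes I: "finite I" "I \<subseteq> J" and x: "x \<in> I" and P: "band P" and Q: "band Q"
  obtains K where "band K" "K (\<Sum>I) = P x" "K (P x) = P x"
    "region I (\<lambda>f. Q (K f)) = region I Q \<inter> region {x} P"
    "region I (\<lambda>f. Q (f - K f)) = region I Q - region {x} P"
proof -
  obtain R where R: "band R" "R x = x" "\<And>y. y \<in> I - {x} \<Longrightarrow> R y = 0"
    by (rule finite_separation[OF J, of "I - {x}" x]) (use I x in auto)
  define K where "K f = P (R f)" for f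
  have K: "band K" unfolding K_def using P R(1) by (rule band_comp)
  have Ky: "K y = 0" if "y \<in> I" "y \<noteq> x" for y
    using R that by (auto simp: K_def band_zero_arg[OF P])
  have Kx: "K x = P x" using R by (simp add: K_def)
  show thesis
  proof (rule that[OF K])
    have "K (\<Sum>I) = (\<Sum>y\<in>I. K y)" using band_sum[OF K, of "\<lambda>x. x" I] by simp
    also have "\<dots> = (\<Sum>y\<in>I. if y = x then P x else 0)" using Ky Kx by (intro sum.cong) auto
    finally show "K (\<Sum>I) = P x" using I x by simp
    show "K (P x) = P x" using band_commute[OF R(1) P, of x] R(2) band_idem[OF P] by (simp add: K_def)
    have c: "clopen y (\<lambda>f. Q (K f)) = clopen y Q \<inter> (if y = x then clopen x P else {})"
      "clopen y (\<lambda>f. Q (f - K f)) = clopen y Q - (if y = x then clopen x P else {})" if "y \<in> I" for y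
    proof -
      have k: "clopen y K = (if y = x then clopen x P else {})"
        using Kx Ky[OF that] clopen_empty_iff[OF K, of y] by (auto simp: clopen_def)
      show "clopen y (\<lambda>f. Q (K f)) = clopen y Q \<inter> (if y = x then clopen x P else {})"
        unfolding k[symmetric] by (rule clopen_inter[OF Q K, symmetric])
      have "clopen y Q - clopen y K = clopen y Q \<inter> (ultra y - clopen y K)" by (auto simp: clopen_def)
      then show "clopen y (\<lambda>f. Q (f - K f)) = clopen y Q - (if y = x then clopen x P else {})"
        unfolding k[symmetric] clopen_compl[OF K] clopen_inter[OF Q band_compl[OF K]] by (rule sym)
    qed
    show "region I (\<lambda>f. Q (K f)) = region I Q \<inter> region {x} P"
      using c(1) x by (auto simp: region_def split: if_splits)
    show "region I (\<lambda>f. Q (f - K f)) = region I Q - region {x} P"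
      using c(2) x by (auto simp: region_def split: if_splits)
  qed
qed

text \<open>
  The additional constant \<open>c\<close> and the localisation \<open>Q\<close> make an induction over the list possible without
  disjoint representations of step functions. The region is cut into the clopen set of the first entry and the
  rest: on the first piece the entry adds \<open>c1\<close> to the constant, on the second it vanishes. The norm splits
  accordingly by \<open>norm_band_split\<close>.
\<close>

lemma integral_step_on_region:
  assumes I: "finite I" "I \<subseteq> J" and "step_data xs" "(\<lambda>(c, P, x). x) ` set xs \<subseteq> I" "band Q"
  shows "(\<integral>z. indicator (region I Q) z * \<bar>c + step_function xs z\<bar> \<partial>M) = norm (Q (c *\<^sub>R \<Sum>I + step_vector xs))"
  using assms(3-)
proof (induction xs arbitrary: c Q)
  case Nil
  have "measure M (region I Q) = norm (Q (\<Sum>I))"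
    using emeasure_region[OF I Nil(3)] by (simp add: measure_def)
  then show ?case using Nil region_in_sets[OF I(2) Nil(3)]
    by (simp add: band_scale mult.commute)
next
  case (Cons a xs)
  obtain c1 P x where a: "a = (c1, P, x)" by (cases a)
  have P: "band P" and x: "x \<in> I" and xs: "step_data xs" "(\<lambda>(c, P, x). x) ` set xs \<subseteq> I" and Q: "band Q"
    using Cons.prems by (auto simp: a)
  obtain K where K: "band K" "K (\<Sum>I) = P x" "K (P x) = P x"
    "region I (\<lambda>f. Q (K f)) = region I Q \<inter> region {x} P"
    "region I (\<lambda>f. Q (f - K f)) = region I Q - region {x} P"
    by (rule region_split[OF I x P Q])
  have QK: "band (\<lambda>f. Q (K f))" and QL: "band (\<lambda>f. Q (f - K f))"
    using band_comp[OF Q K(1)] band_comp[OF Q band_compl[OF K(1)]] by auto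
  have int: "integrable M (\<lambda>z. indicator (region I S) z * \<bar>b + step_function xs z\<bar>)" if S: "band S" for S b
  proof -
    have "integrable M (\<lambda>z. b * indicator (region I S) z)"
      using integrable_region[OF I S] by (intro integrable_mult_right)
    note i = Bochner_Integration.integrable_add[OF this
      integrable_real_mult_indicator[OF region_in_sets[OF I(2) S] integrable_step[OF xs(1)]]]
    have eq: "(\<lambda>z. indicator (region I S) z * \<bar>b + step_function xs z\<bar>) =
        (\<lambda>z. \<bar>b * indicator (region I S) z + step_function xs z * indicator (region I S) z\<bar>)"
      by (auto simp: indicator_def fun_eq_iff)
    show ?thesis unfolding eq by (rule integrable_abs[OF i])
  qed
  have "(\<integral>z. indicator (region I Q) z * \<bar>c + step_function (a # xs) z\<bar> \<partial>M) =
    (\<integral>z. indicator (region I (\<lambda>f. Q (K f))) z * \<bar>(c + c1) + step_function xs z\<bar> +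
      indicator (region I (\<lambda>f. Q (f - K f))) z * \<bar>c + step_function xs z\<bar> \<partial>M)"
    unfolding K(4,5) by (intro Bochner_Integration.integral_cong) (auto simp: a indicator_def)
  also have "\<dots> = norm (Q (K ((c + c1) *\<^sub>R \<Sum>I + step_vector xs))) + norm (Q (c *\<^sub>R \<Sum>I + step_vector xs - K (c *\<^sub>R \<Sum>I + step_vector xs)))"
    using int[OF QK] int[OF QL] Cons.IH[OF xs QK] Cons.IH[OF xs QL] by simp
  also have "K ((c + c1) *\<^sub>R \<Sum>I + step_vector xs) = K (c *\<^sub>R \<Sum>I + step_vector (a # xs))"
    by (simp add: a band_add[OF K(1)] band_scale[OF K(1)] K(2,3) scaleR_add_left)
  also have "c *\<^sub>R \<Sum>I + step_vector xs - K (c *\<^sub>R \<Sum>I + step_vector xs) =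
      c *\<^sub>R \<Sum>I + step_vector (a # xs) - K (c *\<^sub>R \<Sum>I + step_vector (a # xs))"
    by (simp add: a band_add[OF K(1)] band_scale[OF K(1)] K(3))
  also have "norm (Q (K (c *\<^sub>R \<Sum>I + step_vector (a # xs)))) + norm (Q (c *\<^sub>R \<Sum>I + step_vector (a # xs) - K (c *\<^sub>R \<Sum>I + step_vector (a # xs))))
      = norm (Q (c *\<^sub>R \<Sum>I + step_vector (a # xs)))"
    using norm_band_split[OF K(1), of "Q (c *\<^sub>R \<Sum>I + step_vector (a # xs))"] band_commute[OF K(1) Q]
    by (simp only: band_diff[OF Q])
  finally show ?case .
qed

lemma integral_abs_step:
  assumes xs: "step_data xs" shows "(\<integral>z. \<bar>step_function xs z\<bar> \<partial>M) = norm (step_vector xs)"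
proof -
  define I where "I = (\<lambda>(c, P, x). x) ` set xs"
  have I: "finite I" "I \<subseteq> J" using xs by (auto simp: I_def step_data_def)
  have supp: "step_function ys z = 0" if "z \<notin> region I (\<lambda>f. f)" "set ys \<subseteq> set xs" for ys z
    using that
  proof (induction ys)
    case (Cons a ys)
    obtain c P x where a: "a = (c, P, x)" by (cases a)
    have "x \<in> I" using Cons.prems(2) by (force simp: a I_def)
    then have "z \<notin> region {x} P"
      using Cons.prems(1) meet_closedD(1) by (auto simp: region_def clopen_def ultra_def)
    then show ?case using Cons by (simp add: a)
  qed simp
  have "(\<integral>z. \<bar>step_function xs z\<bar> \<partial>M) = (\<integral>z. indicator (region I (\<lambda>f. f)) z * \<bar>0 + step_function xs z\<bar> \<partial>M)"
    using supp by (intro Bochner_Integration.integral_cong) (auto simp: indicator_def)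
  also have "\<dots> = norm (0 *\<^sub>R \<Sum>I + step_vector xs)"
    using integral_step_on_region[OF I xs _ band_id, of 0] by (simp add: I_def)
  finally show ?thesis by simp
qed

lemma integral_abs_step_diff:
  assumes "step_data xs" "step_data ys"
  shows "(\<integral>z. \<bar>step_function xs z - step_function ys z\<bar> \<partial>M) = norm (step_vector xs - step_vector ys)"
  using integral_abs_step[of "xs @ scaled (- 1) ys"] assms
  by (simp add: step_function_append step_function_scaled step_vector_append step_vector_scaled)

end

section \<open>The isometry between vectors and integrable functions\<close>

lemma countable_support_of_nn_integral_count_space:
  assumes "(\<integral>\<^sup>+x. f x \<partial>count_space J) < \<infinity>"
  shows "countable {x\<in>J. f x \<noteq> 0}"
proof -
  have fin: "finite {x\<in>J. f x \<ge> ennreal (1 / real (Suc n))}" for n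
  proof -
    let ?c = "ennreal (1 / real (Suc n))"
    let ?A = "{x\<in>J. f x \<ge> ?c}"
    have "?c * emeasure (count_space J) ?A = (\<integral>\<^sup>+x. ?c * indicator ?A x \<partial>count_space J)"
      by (rule nn_integral_cmult_indicator[symmetric]) auto
    also have "\<dots> \<le> (\<integral>\<^sup>+x. f x \<partial>count_space J)"
      by (rule nn_integral_mono) (auto simp: indicator_def)
    finally have "?c * emeasure (count_space J) ?A < \<infinity>" using assms by (rule le_less_trans)
    then have "emeasure (count_space J) ?A \<noteq> \<infinity>"
      by (auto simp: ennreal_mult_less_top less_top)
    then show ?thesis by (subst (asm) emeasure_count_space) (auto split: if_splits)
  qed
  \<comment> \<open>Each of the sets above is finite by the Markov inequality, and together they exhaust the support.\<close>
  have "{x\<in>J. f x \<noteq> 0} \<subseteq> (\<Union>n. {x\<in>J. f x \<ge> ennreal (1 / real (Suc n))})"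
  proof
    fix x assume x: "x \<in> {x\<in>J. f x \<noteq> 0}"
    show "x \<in> (\<Union>n. {x\<in>J. f x \<ge> ennreal (1 / real (Suc n))})"
    proof (cases "f x")
      case (real r)
      then have "r > 0" using x by (auto simp: less_le)
      then obtain n where "1 / real (Suc n) < r" using reals_Archimedean[of r] by (auto simp: inverse_eq_divide)
      then show ?thesis using x real by (auto intro!: exI[of _ n] ennreal_leI)
    next
      case top
      then show ?thesis using x by auto
    qed
  qed
  moreover have "countable (\<Union>n. {x\<in>J. f x \<ge> ennreal (1 / real (Suc n))})"
    by (rule countable_UN[OF countableI_type countable_finite[OF fin]])
  ultimately show ?thesis by (rule countable_subset)
qed

context al_space_units
begin

text \<open>
  The closure, in the product of \<open>Z\<close> and L1, of the graph of the map from combinations of components to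
  step functions.
\<close>

definition represents :: "'a \<Rightarrow> ('a \<times> 'a set \<Rightarrow> real) \<Rightarrow> bool" where
  "represents f h \<longleftrightarrow> integrable M h \<and>
     (\<forall>\<epsilon>>0. \<exists>xs. step_data xs \<and> norm (f - step_vector xs) < \<epsilon> \<and> (\<integral>z. \<bar>h z - step_function xs z\<bar> \<partial>M) < \<epsilon>)"

lemma represents_integrable: "represents f h \<Longrightarrow> integrable M h"
  by (simp add: represents_def)

lemma representsE:
  assumes "represents f h" "\<epsilon> > 0"
  obtains xs where "step_data xs" "norm (f - step_vector xs) < \<epsilon>" "(\<integral>z. \<bar>h z - step_function xs z\<bar> \<partial>M) < \<epsilon>"
  using assms unfolding represents_def by blast

lemma L1_triangle:
  fixes u v w :: "_ \<Rightarrow> real"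
  assumes "integrable M u" "integrable M v" "integrable M w"
  shows "(\<integral>z. \<bar>u z - w z\<bar> \<partial>M) \<le> (\<integral>z. \<bar>u z - v z\<bar> \<partial>M) + (\<integral>z. \<bar>v z - w z\<bar> \<partial>M)"
proof -
  have "(\<integral>z. \<bar>u z - w z\<bar> \<partial>M) \<le> (\<integral>z. \<bar>u z - v z\<bar> + \<bar>v z - w z\<bar> \<partial>M)"
    using assms by (intro integral_mono) auto
  also have "\<dots> = (\<integral>z. \<bar>u z - v z\<bar> \<partial>M) + (\<integral>z. \<bar>v z - w z\<bar> \<partial>M)"
    using assms by (intro Bochner_Integration.integral_add) auto
  finally show ?thesis .
qed

lemma represents_step:
  assumes "step_data xs" shows "represents (step_vector xs) (step_function xs)"
  unfolding represents_def
proof (intro conjI allI impI)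
  fix \<epsilon> :: real assume "\<epsilon> > 0"
  then show "\<exists>ys. step_data ys \<and> norm (step_vector xs - step_vector ys) < \<epsilon> \<and> (\<integral>z. \<bar>step_function xs z - step_function ys z\<bar> \<partial>M) < \<epsilon>"
    using assms by (intro exI[of _ xs]) auto
qed (rule integrable_step[OF assms])

lemma represents_norm:
  assumes "represents f h" shows "(\<integral>z. \<bar>h z\<bar> \<partial>M) = norm f"
proof -
  have "\<bar>(\<integral>z. \<bar>h z\<bar> \<partial>M) - norm f\<bar> \<le> \<epsilon>" if \<epsilon>: "\<epsilon> > 0" for \<epsilon>
  proof -
    obtain xs where xs: "step_data xs" "norm (f - step_vector xs) < \<epsilon> / 2" "(\<integral>z. \<bar>h z - step_function xs z\<bar> \<partial>M) < \<epsilon> / 2"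
      using representsE[OF assms, of "\<epsilon> / 2"] \<epsilon> by auto
    note int = represents_integrable[OF assms] integrable_step[OF xs(1)]
    have "(\<integral>z. \<bar>h z\<bar> \<partial>M) \<le> (\<integral>z. \<bar>h z - step_function xs z\<bar> \<partial>M) + norm (step_vector xs)"
      using L1_triangle[OF int(1) int(2), of "\<lambda>_. 0"] integral_abs_step[OF xs(1)] by simp
    moreover have "norm (step_vector xs) \<le> (\<integral>z. \<bar>h z - step_function xs z\<bar> \<partial>M) + (\<integral>z. \<bar>h z\<bar> \<partial>M)"
      using L1_triangle[OF int(2) int(1), of "\<lambda>_. 0"] integral_abs_step[OF xs(1)]
      by (simp add: abs_minus_commute)
    moreover have "\<bar>norm f - norm (step_vector xs)\<bar> < \<epsilon> / 2"
      using norm_triangle_ineq3[of f "step_vector xs"] xs(2) by linarith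
    ultimately show ?thesis using xs(3) by linarith
  qed
  then have "\<bar>(\<integral>z. \<bar>h z\<bar> \<partial>M) - norm f\<bar> \<le> 0" by (rule field_le_epsilon) simp
  then show ?thesis by simp
qed

lemma represents_add:
  assumes "represents f h" "represents g k"
  shows "represents (f + g) (\<lambda>z. h z + k z)"
  unfolding represents_def
proof (intro conjI allI impI)
  fix \<epsilon> :: real assume \<epsilon>: "\<epsilon> > 0"
  obtain xs where xs: "step_data xs" "norm (f - step_vector xs) < \<epsilon> / 2" "(\<integral>z. \<bar>h z - step_function xs z\<bar> \<partial>M) < \<epsilon> / 2"
    using representsE[OF assms(1), of "\<epsilon> / 2"] \<epsilon> by auto
  obtain ys where ys: "step_data ys" "norm (g - step_vector ys) < \<epsilon> / 2" "(\<integral>z. \<bar>k z - step_function ys z\<bar> \<partial>M) < \<epsilon> / 2"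
    using representsE[OF assms(2), of "\<epsilon> / 2"] \<epsilon> by auto
  have "norm (f + g - step_vector (xs @ ys)) \<le> norm (f - step_vector xs) + norm (g - step_vector ys)"
    using norm_triangle_ineq[of "f - step_vector xs" "g - step_vector ys"] by (simp add: step_vector_append algebra_simps)
  moreover have "(\<integral>z. \<bar>h z + k z - step_function (xs @ ys) z\<bar> \<partial>M)
      \<le> (\<integral>z. \<bar>h z - step_function xs z\<bar> + \<bar>k z - step_function ys z\<bar> \<partial>M)"
    using assms[THEN represents_integrable] xs(1) ys(1) integrable_step
    by (intro integral_mono) (auto simp: step_function_append)
  moreover have "\<dots> = (\<integral>z. \<bar>h z - step_function xs z\<bar> \<partial>M) + (\<integral>z. \<bar>k z - step_function ys z\<bar> \<partial>M)"
    using assms[THEN represents_integrable] xs(1) ys(1) integrable_step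
    by (intro Bochner_Integration.integral_add) auto
  ultimately show "\<exists>zs. step_data zs \<and> norm (f + g - step_vector zs) < \<epsilon> \<and>
      (\<integral>z. \<bar>h z + k z - step_function zs z\<bar> \<partial>M) < \<epsilon>"
    using xs ys by (intro exI[of _ "xs @ ys"]) auto
qed (use assms represents_integrable in auto)

lemma represents_scale:
  assumes "represents f h"
  shows "represents (a *\<^sub>R f) (\<lambda>z. a * h z)"
  unfolding represents_def
proof (intro conjI allI impI)
  fix \<epsilon> :: real assume \<epsilon>: "\<epsilon> > 0"
  define \<delta> where "\<delta> = \<epsilon> / (\<bar>a\<bar> + 1)"
  have \<delta>: "\<delta> > 0" "\<bar>a\<bar> * \<delta> < \<epsilon>" using \<epsilon> by (auto simp: \<delta>_def field_simps)
  obtain xs where xs: "step_data xs" "norm (f - step_vector xs) < \<delta>" "(\<integral>z. \<bar>h z - step_function xs z\<bar> \<partial>M) < \<delta>"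
    by (rule representsE[OF assms \<delta>(1)])
  have "norm (a *\<^sub>R f - step_vector (scaled a xs)) = \<bar>a\<bar> * norm (f - step_vector xs)"
    by (simp add: step_vector_scaled flip: scaleR_diff_right)
  moreover have "(\<integral>z. \<bar>a * h z - step_function (scaled a xs) z\<bar> \<partial>M) = \<bar>a\<bar> * (\<integral>z. \<bar>h z - step_function xs z\<bar> \<partial>M)"
    by (simp add: step_function_scaled abs_mult flip: right_diff_distrib)
  ultimately show "\<exists>zs. step_data zs \<and> norm (a *\<^sub>R f - step_vector zs) < \<epsilon> \<and>
      (\<integral>z. \<bar>a * h z - step_function zs z\<bar> \<partial>M) < \<epsilon>"
    using xs \<delta>(2) mult_left_mono[of "norm (f - step_vector xs)" \<delta> "\<bar>a\<bar>"]
      mult_left_mono[of "(\<integral>z. \<bar>h z - step_function xs z\<bar> \<partial>M)" \<delta> "\<bar>a\<bar>"]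
    by (intro exI[of _ "scaled a xs"]) auto
qed (use assms represents_integrable in auto)

lemma represents_diff:
  assumes "represents f h" "represents g k"
  shows "represents (f - g) (\<lambda>z. h z - k z)"
  using represents_add[OF assms(1) represents_scale[OF assms(2), of "-1"]] by simp

lemma represents_unique_vector:
  assumes "represents f h" "represents g h" shows "f = g"
  using represents_norm[OF represents_diff[OF assms]] by simp

lemma represents_unique_function:
  assumes "represents f h" "represents f k" shows "AE z in M. h z = k z"
proof -
  have "(\<integral>z. \<bar>h z - k z\<bar> \<partial>M) = 0" using represents_norm[OF represents_diff[OF assms]] by simp
  then have "AE z in M. \<bar>h z - k z\<bar> = 0"
    using assms[THEN represents_integrable] by (subst (asm) integral_nonneg_eq_0_iff_AE) auto
  then show ?thesis by eventually_elim simp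
qed

lemma represents_cong_AE:
  assumes "represents f h" "integrable M k" "AE z in M. h z = k z"
  shows "represents f k"
proof -
  have "(\<integral>z. \<bar>k z - step_function xs z\<bar> \<partial>M) = (\<integral>z. \<bar>h z - step_function xs z\<bar> \<partial>M)" if "step_data xs" for xs
    using assms(3) represents_integrable[OF assms(1)] assms(2) integrable_step[OF that]
    by (intro integral_cong_AE) (auto elim!: eventually_mono)
  then show ?thesis using assms(1,2) unfolding represents_def by metis
qed

lemma span_components_vec:
  assumes "f \<in> span (\<Union>x\<in>J. components x)"
  shows "\<exists>xs. step_data xs \<and> step_vector xs = f"
  using assms
proof (induction rule: span_induct_alt)
  case base
  then show ?case by (intro exI[of _ "[]"]) simp
next
  case (step c g f)
  then obtain xs where xs: "step_data xs" "step_vector xs = f" by blast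
  obtain x P where "x \<in> J" "band P" "g = P x" using step by (auto simp: components_def)
  then show ?case using xs by (intro exI[of _ "(c, P, x) # xs"]) simp
qed

lemma step_vector_approximates:
  assumes "\<epsilon> > 0" obtains xs where "step_data xs" "norm (f - step_vector xs) < \<epsilon>"
proof -
  have "f \<in> closure (span (\<Union>x\<in>J. components x))" using dense by simp
  then obtain g where "g \<in> span (\<Union>x\<in>J. components x)" "dist g f < \<epsilon>"
    using assms by (auto simp: closure_approachable)
  then show thesis using span_components_vec[of g] that by (auto simp: dist_norm norm_minus_commute)
qed

lemma half_power_small: "\<epsilon> > 0 \<Longrightarrow> \<exists>n. (1/2::real) ^ n < \<epsilon>"
  by (rule real_arch_pow_inv) auto

text \<open>
  The step functions of a fast approximating sequence of \<open>f\<close> are a fast Cauchy sequence in L1, because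
  differences of step functions have the norms of the differences of their vectors.
\<close>

lemma represents_total: "\<exists>h. represents f h"
proof -
  have "\<exists>xs. step_data xs \<and> norm (f - step_vector xs) < (1/4) * (1/2) ^ n" for n
    using step_vector_approximates[of "(1/4) * (1/2) ^ n" f] by auto
  then obtain X where X: "\<And>n. step_data (X n)" "\<And>n. norm (f - step_vector (X n)) < (1/4) * (1/2) ^ n" by metis
  have "(\<integral>z. \<bar>step_function (X (Suc n)) z - step_function (X n) z\<bar> \<partial>M) \<le> (1/2) ^ n" for n
  proof -
    have "(\<integral>z. \<bar>step_function (X (Suc n)) z - step_function (X n) z\<bar> \<partial>M) = norm (step_vector (X (Suc n)) - step_vector (X n))"
      by (rule integral_abs_step_diff[OF X(1) X(1)])
    also have "\<dots> \<le> norm (f - step_vector (X n)) + norm (f - step_vector (X (Suc n)))"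
      using norm_triangle_ineq4[of "f - step_vector (X n)" "f - step_vector (X (Suc n))"] by simp
    also have "\<dots> \<le> (1/4) * (1/2) ^ n + (1/4) * (1/2) ^ Suc n" using X(2) by (intro add_mono less_imp_le)
    also have "\<dots> \<le> (1/2) ^ n" by simp
    finally show ?thesis .
  qed
  then obtain h where h: "integrable M h" "(\<lambda>n. \<integral>z. \<bar>step_function (X n) z - h z\<bar> \<partial>M) \<longlonglongrightarrow> 0"
    using L1_limit_of_fast_Cauchy[of M "\<lambda>n. step_function (X n)"] integrable_step[OF X(1)] by blast
  have "represents f h"
    unfolding represents_def
  proof (intro conjI allI impI h(1))
    fix \<epsilon> :: real assume \<epsilon>: "\<epsilon> > 0"
    have "eventually (\<lambda>n. (\<integral>z. \<bar>step_function (X n) z - h z\<bar> \<partial>M) < \<epsilon>) sequentially"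
      using h(2) \<epsilon> by (rule order_tendstoD(2))
    moreover have "(\<lambda>n. (1/2::real) ^ n) \<longlonglongrightarrow> 0" by (rule LIMSEQ_power_zero) simp
    then have "eventually (\<lambda>n. (1/2) ^ n < \<epsilon>) sequentially" using \<epsilon> by (rule order_tendstoD(2))
    ultimately have "eventually (\<lambda>n. (\<integral>z. \<bar>step_function (X n) z - h z\<bar> \<partial>M) < \<epsilon> \<and> (1/2) ^ n < \<epsilon>) sequentially"
      by (rule eventually_conj)
    then obtain n where n: "(\<integral>z. \<bar>step_function (X n) z - h z\<bar> \<partial>M) < \<epsilon>" "(1/2) ^ n < \<epsilon>"
      using eventually_happens'[OF sequentially_bot] by blast
    have "norm (f - step_vector (X n)) < \<epsilon>" using X(2)[of n] n(2) zero_less_power[of "1/2::real" n] by linarith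
    then show "\<exists>xs. step_data xs \<and> norm (f - step_vector xs) < \<epsilon> \<and> (\<integral>z. \<bar>h z - step_function xs z\<bar> \<partial>M) < \<epsilon>"
      using X(1) n(1) by (intro exI[of _ "X n"]) (simp add: abs_minus_commute)
  qed
  then show ?thesis by blast
qed

definition representable :: "('a \<times> 'a set \<Rightarrow> real) \<Rightarrow> bool" where
  "representable h \<longleftrightarrow> (\<exists>f. represents f h)"

text \<open>
  Here completeness of \<open>Z\<close> is used: approximating step functions have approximating vectors, which form a Cauchy
  sequence.
\<close>

lemma representable_closed:
  assumes h: "integrable M h"
    and approx: "\<And>\<epsilon>. \<epsilon> > 0 \<Longrightarrow> \<exists>k. representable k \<and> (\<integral>z. \<bar>h z - k z\<bar> \<partial>M) < \<epsilon>"
  shows "representable h"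
proof -
  have "\<exists>xs. step_data xs \<and> (\<integral>z. \<bar>h z - step_function xs z\<bar> \<partial>M) < (1/2) ^ n" for n
  proof -
    define \<epsilon> :: real where "\<epsilon> = (1/2) ^ n / 2"
    have \<epsilon>: "\<epsilon> > 0" by (simp add: \<epsilon>_def)
    obtain k f where k: "represents f k" "(\<integral>z. \<bar>h z - k z\<bar> \<partial>M) < \<epsilon>"
      using approx[OF \<epsilon>] by (auto simp: representable_def)
    obtain xs where xs: "step_data xs" "(\<integral>z. \<bar>k z - step_function xs z\<bar> \<partial>M) < \<epsilon>"
      using representsE[OF k(1) \<epsilon>] by blast
    have "(\<integral>z. \<bar>h z - step_function xs z\<bar> \<partial>M) < \<epsilon> + \<epsilon>"
      using L1_triangle[OF h represents_integrable[OF k(1)] integrable_step[OF xs(1)]] k(2) xs(2) by linarith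
    then show ?thesis using xs(1) by (auto simp: \<epsilon>_def)
  qed
  then obtain X where X: "\<And>n. step_data (X n)" "\<And>n. (\<integral>z. \<bar>h z - step_function (X n) z\<bar> \<partial>M) < (1/2) ^ n" by metis
  have dist: "norm (step_vector (X n) - step_vector (X m)) < (1/2) ^ n + (1/2) ^ m" for n m
  proof -
    have "norm (step_vector (X n) - step_vector (X m)) = (\<integral>z. \<bar>step_function (X n) z - step_function (X m) z\<bar> \<partial>M)"
      using integral_abs_step_diff[OF X(1) X(1)] by simp
    also have "\<dots> \<le> (\<integral>z. \<bar>step_function (X n) z - h z\<bar> \<partial>M) + (\<integral>z. \<bar>h z - step_function (X m) z\<bar> \<partial>M)"
      by (rule L1_triangle[OF integrable_step[OF X(1)] h integrable_step[OF X(1)]])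
    also have "\<dots> < (1/2) ^ n + (1/2) ^ m"
      using X(2)[of n] X(2)[of m] by (simp add: abs_minus_commute)
    finally show ?thesis .
  qed
  have "Cauchy (\<lambda>n. step_vector (X n))"
  proof (rule CauchyI)
    fix \<epsilon> :: real assume \<epsilon>: "\<epsilon> > 0"
    obtain N where N: "(1/2::real) ^ N < \<epsilon> / 2" using half_power_small[of "\<epsilon> / 2"] \<epsilon> by auto
    have "norm (step_vector (X m) - step_vector (X n)) < \<epsilon>" if "m \<ge> N" "n \<ge> N" for m n
    proof -
      have "(1/2::real) ^ m \<le> (1/2) ^ N" "(1/2::real) ^ n \<le> (1/2) ^ N"
        using that by (intro power_decreasing; simp)+
      then show ?thesis using dist[of m n] N by linarith
    qed
    then show "\<exists>N. \<forall>m\<ge>N. \<forall>n\<ge>N. norm (step_vector (X m) - step_vector (X n)) < \<epsilon>" by blast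
  qed
  then obtain f where f: "(\<lambda>n. step_vector (X n)) \<longlonglongrightarrow> f" using Cauchy_convergent convergent_def by blast
  have "represents f h"
    unfolding represents_def
  proof (intro conjI allI impI h)
    fix \<epsilon> :: real assume \<epsilon>: "\<epsilon> > 0"
    obtain N where N: "(1/2::real) ^ N < \<epsilon>" using half_power_small[OF \<epsilon>] by auto
    obtain N' where N': "\<And>n. n \<ge> N' \<Longrightarrow> norm (step_vector (X n) - f) < \<epsilon>"
      using LIMSEQ_D[OF f \<epsilon>] by blast
    define n where "n = max N N'"
    have "(\<integral>z. \<bar>h z - step_function (X n) z\<bar> \<partial>M) < \<epsilon>"
    proof -
      have "(1/2::real) ^ n \<le> (1/2) ^ N" by (rule power_decreasing) (simp_all add: n_def)
      then show ?thesis using X(2)[of n] N by linarith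
    qed
    moreover have "norm (f - step_vector (X n)) < \<epsilon>" using N'[of n] by (simp add: n_def norm_minus_commute)
    ultimately show "\<exists>xs. step_data xs \<and> norm (f - step_vector xs) < \<epsilon> \<and> (\<integral>z. \<bar>h z - step_function xs z\<bar> \<partial>M) < \<epsilon>"
      using X(1) by blast
  qed
  then show ?thesis by (auto simp: representable_def)
qed

lemma representable_add: "representable h \<Longrightarrow> representable k \<Longrightarrow> representable (\<lambda>z. h z + k z)"
  unfolding representable_def using represents_add by blast

lemma representable_scale: "representable h \<Longrightarrow> representable (\<lambda>z. a * h z)"
  unfolding representable_def using represents_scale by blast

lemma representable_diff: "representable h \<Longrightarrow> representable k \<Longrightarrow> representable (\<lambda>z. h z - k z)"
  unfolding representable_def using represents_diff by blast

lemma representable_zero: "representable (\<lambda>z. 0)"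
proof -
  have "step_function [] = (\<lambda>z. 0)" by auto
  then show ?thesis using represents_step[of "[]"] by (auto simp: representable_def)
qed

lemma representable_empty: "representable (indicator {})"
proof -
  have "(indicator {} :: 'a \<times> 'a set \<Rightarrow> real) = (\<lambda>z. 0)" by (simp add: fun_eq_iff)
  then show ?thesis using representable_zero by simp
qed

lemma representable_sum: "finite I \<Longrightarrow> (\<And>i. i \<in> I \<Longrightarrow> representable (h i)) \<Longrightarrow> representable (\<lambda>z. \<Sum>i\<in>I. h i z)"
  by (induction I rule: finite_induct) (auto intro: representable_zero representable_add)

lemma representable_limit:
  assumes lim: "(\<lambda>n. \<integral>z. \<bar>h z - k n z\<bar> \<partial>M) \<longlonglongrightarrow> 0" and h: "integrable M h" and k: "\<And>n. representable (k n)"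
  shows "representable h"
proof (rule representable_closed[OF h])
  fix \<epsilon> :: real assume "\<epsilon> > 0"
  from order_tendstoD(2)[OF lim this]
  obtain n where "(\<integral>z. \<bar>h z - k n z\<bar> \<partial>M) < \<epsilon>" using eventually_happens'[OF sequentially_bot] by blast
  then show "\<exists>k. representable k \<and> (\<integral>z. \<bar>h z - k z\<bar> \<partial>M) < \<epsilon>" using k by blast
qed

lemma representable_disjoint_union:
  assumes A: "\<And>n::nat. A n \<in> sets M" "disjoint_family A" "emeasure M (\<Union>n. A n) < \<infinity>"
    and rep: "\<And>n. representable (indicator (A n))"
  shows "representable (indicator (\<Union>n. A n))"
proof (rule representable_limit[where k = "\<lambda>n z. \<Sum>i<n. indicator (A i) z"])
  have U: "(\<Union>n. A n) \<in> sets M" using A(1) by blast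
  show int: "integrable M (indicator (\<Union>n. A n) :: _ \<Rightarrow> real)"
    using U A(3) by (rule integrable_real_indicator)
  show "representable (\<lambda>z. \<Sum>i<n. indicator (A i) z)" for n
    using rep by (intro representable_sum) auto
  have dj: "(\<Sum>i<n. indicator (A i) z) = (indicator (\<Union>i<n. A i) z :: real)" for n z
    using A(2) by (subst indicator_UN_disjoint) (auto simp: disjoint_family_on_def)
  have "(\<lambda>n. \<integral>z. \<bar>indicator (\<Union>n. A n) z - (\<Sum>i<n. indicator (A i) z)\<bar> \<partial>M) \<longlonglongrightarrow> (\<integral>z. (0::real) \<partial>M)"
  proof (rule integral_dominated_convergence[where w = "indicator (\<Union>n. A n)"])
    show "AE z in M. (\<lambda>n. \<bar>indicator (\<Union>n. A n) z - (\<Sum>i<n. indicator (A i) z)\<bar>) \<longlonglongrightarrow> (0::real)"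
    proof (rule AE_I2)
      fix z
      show "(\<lambda>n. \<bar>indicator (\<Union>n. A n) z - (\<Sum>i<n. indicator (A i) z)\<bar>) \<longlonglongrightarrow> (0::real)"
      proof (cases "z \<in> (\<Union>n. A n)")
        case True
        then obtain m where m: "z \<in> A m" by blast
        have "\<bar>indicator (\<Union>n. A n) z - indicator (\<Union>i<n. A i) z\<bar> = (0::real)" if "n \<ge> Suc m" for n
        proof -
          have "z \<in> (\<Union>i<n. A i)" using m that by auto
          then show ?thesis using True by simp
        qed
        then show ?thesis unfolding dj by (intro tendsto_eventually eventually_sequentiallyI)
      next
        case False
        then show ?thesis unfolding dj by (auto simp: indicator_def)
      qed
    qed
    show "AE z in M. norm \<bar>indicator (\<Union>n. A n) z - (\<Sum>i<n. indicator (A i) z) :: real\<bar> \<le> (indicator (\<Union>n. A n) z :: real)" for n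
      unfolding dj by (rule AE_I2) (auto simp: indicator_def)
    show "(\<lambda>z. \<bar>indicator (\<Union>n. A n) z - (\<Sum>i<n. indicator (A i) z) :: real\<bar>) \<in> borel_measurable M" for n
      using U A(1) by measurable
  qed (use int in auto)
  then show "(\<lambda>n. \<integral>z. \<bar>indicator (\<Union>n. A n) z - (\<Sum>i<n. indicator (A i) z)\<bar> \<partial>M) \<longlonglongrightarrow> (0::real)" by simp
qed

lemma component_space:
  assumes "x \<in> J"
  shows "{x} \<times> ultra x = region {x} (\<lambda>f. f)" "emeasure M ({x} \<times> ultra x) = 1"
proof -
  show *: "{x} \<times> ultra x = region {x} (\<lambda>f. f)"
    using meet_closedD(1) by (auto simp: region_def clopen_def ultra_def)
  show "emeasure M ({x} \<times> ultra x) = 1"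
    unfolding * using emeasure_region[of "{x}", OF _ _ band_id] assms J_norm[OF assms] by simp
qed

text \<open>
  Inside one Stone space of finite measure, the sets with representable indicator form a Dynkin system that
  contains the clopen sets, and these are stable under intersection.
\<close>

lemma representable_slice:
  assumes x: "x \<in> J" and B: "B \<in> sets (stone_measure x)"
  shows "representable (indicator ({x} \<times> B))"
proof -
  have inM: "{x} \<times> B \<in> sets M" if "B \<in> sigma_sets (ultra x) (clopens x)" for B
    using Sigma_in_sets[of "{x}" "\<lambda>_. B"] that x sets_stone_measure[OF x] by simp
  have fin: "emeasure M ({x} \<times> B) < \<infinity>" if "B \<in> sigma_sets (ultra x) (clopens x)" for B
  proof -
    have "B \<subseteq> ultra x" using that sets.sets_into_space[of B "stone_measure x"] sets_stone_measure[OF x] space_stone_measure[OF x] by simp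
    then have "{x} \<times> B \<subseteq> {x} \<times> ultra x" by blast
    moreover have "{x} \<times> ultra x \<in> sets M"
      unfolding component_space(1)[OF x] using x by (intro region_in_sets band_id) simp
    ultimately have "emeasure M ({x} \<times> B) \<le> emeasure M ({x} \<times> ultra x)" by (rule emeasure_mono)
    then show ?thesis using component_space(2)[OF x] by (simp add: order_le_less_trans)
  qed
  have clop: "representable (indicator (region {x} P))" if "band P" for P
  proof -
    have "step_function [(1, P, x)] = indicator (region {x} P)" by (simp add: fun_eq_iff)
    then show ?thesis using represents_step[of "[(1, P, x)]"] that x by (auto simp: representable_def)
  qed
  interpret algebra "ultra x" "clopens x" by (rule algebra_clopens)
  have IS: "Int_stable (clopens x)" by (auto simp: Int_stable_def)
  have BS: "B \<in> sigma_sets (ultra x) (clopens x)" using B sets_stone_measure[OF x] by simp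
  from IS space_closed BS show ?thesis
  proof (induction rule: sigma_sets_induct_disjoint)
    case (basic A)
    then obtain P where "band P" "A = clopen x P" by (auto simp: clopens_def)
    moreover have "region {x} P = {x} \<times> clopen x P" by (auto simp: region_def)
    ultimately show ?case using clop[of P] by simp
  next
    case empty
    show ?case using representable_zero by simp
  next
    case (compl A)
    have A: "A \<subseteq> ultra x" using compl(1) sets.sets_into_space[of A "stone_measure x"] sets_stone_measure[OF x] space_stone_measure[OF x] by simp
    have "indicator ({x} \<times> (ultra x - A)) = (\<lambda>z. indicator ({x} \<times> ultra x) z - indicator ({x} \<times> A) z :: real)"
      using A by (auto simp: indicator_def fun_eq_iff)
    then show ?case
      using representable_diff[OF clop[OF band_id] compl(2)] by (simp add: component_space(1)[OF x])
  next
    case (union A)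
    have eq: "{x} \<times> (\<Union>i. A i) = (\<Union>i. {x} \<times> A i)" by auto
    have "A n \<in> sigma_sets (ultra x) (clopens x)" for n using union(2) by blast
    then have 1: "{x} \<times> A n \<in> sets M" for n by (rule inM)
    have 2: "disjoint_family (\<lambda>i. {x} \<times> A i)" using union(1) by (auto simp: disjoint_family_on_def)
    have "(\<Union>i. A i) \<in> sigma_sets (ultra x) (clopens x)" using union(2) by (intro sigma_sets.Union) auto
    from fin[OF this] have 3: "emeasure M (\<Union>i. {x} \<times> A i) < \<infinity>" unfolding eq .
    show ?case unfolding eq by (rule representable_disjoint_union[OF 1 2 3 union(3)])
  qed
qed

lemma slice_in_sets: "A \<in> sets M \<Longrightarrow> x \<in> J \<Longrightarrow> Pair x -` A \<in> sets (stone_measure x)"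
  by (auto simp: M_def sets_sum_measure)

text \<open>
  The measure of a set is the sum of the measures of its slices, and a finite sum of non-negative terms has
  only countably many non-zero ones. The remaining slices are null, and together they still form a null set,
  however many there are.
\<close>

lemma finite_measure_countable_support:
  assumes A: "A \<in> sets M" "emeasure M A < \<infinity>"
  obtains J0 where "countable J0" "J0 \<subseteq> J" "{z \<in> A. fst z \<notin> J0} \<in> null_sets M"
proof
  define J0 where "J0 = {x\<in>J. emeasure (stone_measure x) (Pair x -` A) \<noteq> 0}"
  have "(\<integral>\<^sup>+x. emeasure (stone_measure x) (Pair x -` A) \<partial>count_space J) < \<infinity>"
    using A emeasure_sum_measure[of A J stone_measure] by (simp add: M_def)
  then show "countable J0" unfolding J0_def by (rule countable_support_of_nn_integral_count_space)
  show "J0 \<subseteq> J" by (auto simp: J0_def)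
  have B: "{z \<in> A. fst z \<notin> J0} \<in> sets M"
  proof -
    have "Pair x -` {z \<in> A. fst z \<notin> J0} = (if x \<in> J0 then {} else Pair x -` A)" for x by auto
    then show ?thesis using A(1) by (auto simp: M_def sets_sum_measure)
  qed
  have "emeasure M {z \<in> A. fst z \<notin> J0} = (\<integral>\<^sup>+x. emeasure (stone_measure x) (Pair x -` {z \<in> A. fst z \<notin> J0}) \<partial>count_space J)"
    using B unfolding M_def by (rule emeasure_sum_measure)
  also have "\<dots> = (\<integral>\<^sup>+x. 0 \<partial>count_space J)"
  proof (rule nn_integral_cong)
    fix x assume "x \<in> space (count_space J)"
    moreover have "Pair x -` {z \<in> A. fst z \<notin> J0} = (if x \<in> J0 then {} else Pair x -` A)" by auto
    ultimately show "emeasure (stone_measure x) (Pair x -` {z \<in> A. fst z \<notin> J0}) = 0" by (auto simp: J0_def)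
  qed
  finally show "{z \<in> A. fst z \<notin> J0} \<in> null_sets M" using B by (simp add: null_sets_def)
qed

lemma direct_sum_property_M: "direct_sum_property M"
proof -
  define \<W> where "\<W> = (\<lambda>x. {x} \<times> ultra x) ` J"
  show ?thesis
    unfolding direct_sum_property_def
  proof (rule exI[of _ \<W>], intro conjI ballI impI)
    have "{x} \<times> ultra x \<in> sets M" if "x \<in> J" for x
      using region_in_sets[OF _ band_id, of "{x}"] that component_space(1)[OF that] by simp
    then show "\<W> \<subseteq> sets M" by (auto simp: \<W>_def)
    show "0 < emeasure M W" "emeasure M W < \<infinity>" if "W \<in> \<W>" for W
      using that component_space(2) by (auto simp: \<W>_def)
    fix A assume A: "A \<in> sets M" "emeasure M A < \<infinity>"
    obtain J0 where J0: "countable J0" "J0 \<subseteq> J" "{z \<in> A. fst z \<notin> J0} \<in> null_sets M"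
      by (rule finite_measure_countable_support[OF A])
    have "A \<subseteq> (SIGMA x:J. space (stone_measure x))" using A(1) by (simp add: M_def sets_sum_measure)
    then have mem: "fst w \<in> J \<and> snd w \<in> ultra (fst w)" if "w \<in> A" for w
      using that space_stone_measure by (cases w) auto
    have eq: "A = (\<Union>W\<in>(\<lambda>x. {x} \<times> ultra x) ` J0. A \<inter> W) \<union> {z \<in> A. fst z \<notin> J0}"
    proof (intro equalityI subsetI)
      fix w assume w: "w \<in> A"
      then have W: "w \<in> A \<inter> ({fst w} \<times> ultra (fst w))" using mem by (simp add: mem_Times_iff)
      show "w \<in> (\<Union>W\<in>(\<lambda>x. {x} \<times> ultra x) ` J0. A \<inter> W) \<union> {z \<in> A. fst z \<notin> J0}"
      proof (cases "fst w \<in> J0")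
        case True
        show ?thesis
        proof (rule UnI1, rule UN_I)
          show "w \<in> A \<inter> ({fst w} \<times> ultra (fst w))" by (rule W)
          show "{fst w} \<times> ultra (fst w) \<in> (\<lambda>x. {x} \<times> ultra x) ` J0" using True by (rule imageI)
        qed
      next
        case False
        then show ?thesis using w by simp
      qed
    next
      fix w assume "w \<in> (\<Union>W\<in>(\<lambda>x. {x} \<times> ultra x) ` J0. A \<inter> W) \<union> {z \<in> A. fst z \<notin> J0}"
      then show "w \<in> A" by auto
    qed
    have "(\<lambda>x. {x} \<times> ultra x) ` J0 \<subseteq> \<W>" "countable ((\<lambda>x. {x} \<times> ultra x) ` J0)"
      using J0(1,2) by (auto simp: \<W>_def)
    moreover have "\<exists>B\<in>null_sets M. A = (\<Union>W\<in>(\<lambda>x. {x} \<times> ultra x) ` J0. A \<inter> W) \<union> B"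
      by (rule bexI[where x = "{z \<in> A. fst z \<notin> J0}"]) (rule eq, rule J0(3))
    ultimately show "\<exists>\<W>\<^sub>0\<subseteq>\<W>. countable \<W>\<^sub>0 \<and> (\<exists>B\<in>null_sets M. A = (\<Union>W\<in>\<W>\<^sub>0. A \<inter> W) \<union> B)"
      by (intro exI[of _ "(\<lambda>x. {x} \<times> ultra x) ` J0"] conjI)
  qed
qed

lemma representable_indicator:
  assumes A: "A \<in> sets M" "emeasure M A < \<infinity>"
  shows "representable (indicator A)"
proof -
  obtain J0 where J0: "countable J0" "J0 \<subseteq> J" "{z \<in> A. fst z \<notin> J0} \<in> null_sets M"
    by (rule finite_measure_countable_support[OF A])
  have slice: "Pair x -` A \<in> sets (stone_measure x)" if "x \<in> J0" for x
    using slice_in_sets[OF A(1)] J0(2) that by blast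
  define S where "S n = {z \<in> A. fst z \<in> J0 \<and> to_nat_on J0 (fst z) = n}" for n
  have S: "S n = {} \<or> (\<exists>x\<in>J0. S n = {x} \<times> (Pair x -` A))" for n
  proof (cases "S n = {}")
    case False
    then obtain x U where z: "x \<in> J0" "to_nat_on J0 x = n" by (auto simp: S_def)
    have uniq: "y \<in> J0 \<and> to_nat_on J0 y = n \<longleftrightarrow> y = x" for y
      using z inj_on_to_nat_on[OF J0(1)] unfolding inj_on_def by metis
    have "S n = {x} \<times> (Pair x -` A)"
    proof (rule set_eqI)
      fix w
      show "w \<in> S n \<longleftrightarrow> w \<in> {x} \<times> (Pair x -` A)"
        using uniq[of "fst w"] by (cases w) (auto simp only: S_def mem_Collect_eq fst_conv mem_Times_iff snd_conv vimage_eq singleton_iff)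
    qed
    then show ?thesis using z by blast
  qed simp
  have SM: "S n \<in> sets M \<and> representable (indicator (S n))" for n
    using S[of n]
  proof
    assume "S n = {}"
    then show ?thesis using representable_empty by simp
  next
    assume "\<exists>x\<in>J0. S n = {x} \<times> (Pair x -` A)"
    then obtain x where x: "x \<in> J0" "S n = {x} \<times> (Pair x -` A)" by blast
    then show ?thesis
      using representable_slice[OF _ slice, of x] Sigma_in_sets[of "{x}" "\<lambda>_. Pair x -` A"] slice[OF x(1)] J0(2)
      by auto
  qed
  have Un: "(\<Union>n. S n) = A - {z \<in> A. fst z \<notin> J0}" by (auto simp: S_def)
  have "emeasure M (\<Union>n. S n) \<le> emeasure M A" using A(1) by (intro emeasure_mono) (auto simp: S_def)
  then have "emeasure M (\<Union>n. S n) < \<infinity>" using A(2) by (rule le_less_trans)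
  moreover have "disjoint_family S" by (auto simp: disjoint_family_on_def S_def)
  ultimately have "representable (indicator (\<Union>n. S n))"
    using SM by (intro representable_disjoint_union) auto
  then obtain f where f: "represents f (indicator (\<Union>n. S n))" by (auto simp: representable_def)
  have "AE z in M. indicator (\<Union>n. S n) z = (indicator A z :: real)"
    using AE_not_in[OF J0(3)] by eventually_elim (auto simp: Un indicator_def)
  then have "represents f (indicator A)"
    using represents_cong_AE[OF f] integrable_real_indicator[OF A] by blast
  then show ?thesis by (auto simp: representable_def)
qed

text \<open>
  Scaled indicators of sets of finite measure generate L1 under sums and dominated limits.
\<close>

lemma representable_integrable:
  assumes "integrable M h" shows "representable h"
  using assms
proof (induction rule: integrable_induct)
  case (base A c)
  then have "representable (\<lambda>z. c * indicator A z)"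
    by (intro representable_scale representable_indicator)
  then show ?case by (simp add: mult.commute)
next
  case (add f g)
  then show ?case by (intro representable_add)
next
  case (lim f s)
  show ?case
  proof (rule representable_limit[where k = s])
    have "(\<lambda>n. \<integral>z. \<bar>f z - s n z\<bar> \<partial>M) \<longlonglongrightarrow> (\<integral>z. 0 \<partial>M)"
    proof (rule integral_dominated_convergence[where w = "\<lambda>z. 3 * \<bar>f z\<bar>"])
      show "AE z in M. (\<lambda>n. \<bar>f z - s n z\<bar>) \<longlonglongrightarrow> 0"
      proof (rule AE_I2)
        fix z assume "z \<in> space M"
        from tendsto_rabs[OF tendsto_diff[OF tendsto_const lim(2)[OF this], of "f z"]]
        show "(\<lambda>n. \<bar>f z - s n z\<bar>) \<longlonglongrightarrow> 0" by simp
      qed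
      show "AE z in M. norm \<bar>f z - s n z\<bar> \<le> 3 * \<bar>f z\<bar>" for n
        using lim(3)[of _ n] by (intro AE_I2) fastforce
      show "(\<lambda>z. \<bar>f z - s n z\<bar>) \<in> borel_measurable M" for n
        using lim by (intro borel_measurable_abs borel_measurable_diff) auto
    qed (use lim in auto)
    then show "(\<lambda>n. \<integral>z. \<bar>f z - s n z\<bar> \<partial>M) \<longlonglongrightarrow> 0" by simp
  qed (use lim in auto)
qed

text \<open>
  The functions that represent a given vector form a single equivalence class of L1, because the relation
  preserves norms of differences.
\<close>

theorem L1_representation: "L1_isometric_isomorphism M (\<lambda>f. {h. represents f h})"
proof -
  have cls: "{h. represents f h} = L1_class M h" if h: "represents f h" for f h
    using represents_integrable[OF h] represents_integrable[of f] represents_unique_function[OF h]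
      represents_cong_AE[OF h]
    by (auto simp: L1_class_def L1_rel_def)
  show ?thesis
    unfolding L1_isometric_isomorphism_def
  proof (intro conjI allI)
    show "bij_betw (\<lambda>f. {h. represents f h}) UNIV (L1_space M)"
      unfolding bij_betw_def
    proof
      show "inj (\<lambda>f. {h. represents f h})"
      proof (rule injI)
        fix f g assume eq: "{h. represents f h} = {h. represents g h}"
        obtain h where h: "represents f h" using represents_total by blast
        then have "represents g h" using eq by blast
        with h show "f = g" by (rule represents_unique_vector)
      qed
      show "range (\<lambda>f. {h. represents f h}) = L1_space M"
        unfolding L1_space_eq
      proof (intro equalityI subsetI)
        fix X assume "X \<in> range (\<lambda>f. {h. represents f h})"
        then obtain f where X: "X = {h. represents f h}" by blast
        obtain h where "represents f h" using represents_total by blast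
        then show "X \<in> L1_class M ` {f. integrable M f}" using cls represents_integrable X by blast
      next
        fix X assume "X \<in> L1_class M ` {f. integrable M f}"
        then obtain h where h: "integrable M h" "X = L1_class M h" by blast
        obtain f where "represents f h" using representable_integrable[OF h(1)] by (auto simp: representable_def)
        then show "X \<in> range (\<lambda>f. {h. represents f h})" using cls h(2) by blast
      qed
    qed
    fix f g :: 'a and c :: real
    obtain h k where h: "represents f h" and k: "represents g k" using represents_total by blast
    show "{h. represents (f + g) h} = L1_add M {h. represents f h} {h. represents g h}"
      unfolding cls[OF h] cls[OF k] cls[OF represents_add[OF h k]]
      by (rule L1_add_class[symmetric]) (rule represents_integrable[OF h], rule represents_integrable[OF k])
    show "{h. represents (c *\<^sub>R f) h} = L1_scale M c {h. represents f h}"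
      unfolding cls[OF h] cls[OF represents_scale[OF h]]
      by (rule L1_scale_class[symmetric, OF represents_integrable[OF h]])
    show "L1_norm M {h. represents f h} = norm f"
      unfolding cls[OF h] using L1_norm_class[OF represents_integrable[OF h]] represents_norm[OF h] by simp
  qed
qed

end

theorem theorem4p2:
  assumes "neutral_space TYPE('a::banach)"
    and "strongly_facially_symmetric TYPE('a)"
    and "\<exists>e :: 'a \<Rightarrow>\<^sub>L real. unitary_tripotent e"
  shows "\<exists>(M :: ('a \<times> 'a set) measure) (T :: 'a \<Rightarrow> ('a \<times> 'a set \<Rightarrow> real) set).
           direct_sum_property M \<and> L1_isometric_isomorphism M T"
proof -
  obtain e :: "'a \<Rightarrow>\<^sub>L real" where e: "unitary_tripotent e" using assms(3) by blast
  interpret unitary_sfs e using assms(1,2) e by unfold_locales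
  interpret al: al_space e
  proof
    show "norm e \<le> 1" using norm_e by simp
    show "\<exists>P. band_projection e P \<and> P f \<in> pos_cone e \<and> P f - f \<in> pos_cone e \<and>
      norm f = norm (P f) + norm (P f - f)" for f
      using split_by_band_projection[of f] by metis
  qed
  obtain J where J: "al.disjoint_units J"
    "\<forall>r\<in>C. (\<forall>x\<in>J. al.separated x r) \<longrightarrow> r = 0"
    by (rule al.maximal_disjoint_units_exist)
  interpret rep: al_space_units e J
    using J(1) al.components_dense[OF J] by unfold_locales
  show ?thesis using rep.direct_sum_property_M rep.L1_representation by blast
qed

end
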